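(* Let $((X_i,Y_i))_{i\geq 1}$ be an i.i.d. sequence such that for each $i$, $X_i$ and $Y_i$ are independent with \[ \mathbb{P}(X_i=k)=\mathbb{P}(Y_i=k)=\frac{1}{k\,2^{2k-1}}\binom{2k-2}{k-1},\qquad k=1,2,3,\dots \] Let $N$ and $M$ be independent Geometric$(1/2)$ random variables, also jointly independent of the sequence $((X_i,Y_i))_{i\geq1}$. For each $n\ge 1$ let $\tau_n$ be a uniformly random element of $\mathrm{Av}_n(321)$. Then, as $n\to\infty$, \[ \left( \sum_{i=1}^{\lfloor n/2\rfloor} \delta_i \mathbf{1}_{\{\tau_n(i)=i\}} ,\ \sum_{i=\lfloor n/2\rfloor+1}^n \delta_{n+1-i} \mathbf{1}_{\{\tau_n(i)=i\}} \right) \overset{d}{\longrightarrow} \left( \sum_{k=1}^{N} \delta_{\sum_{j=1}^k X_j} \mathbf{1}_{\{X_k=1\}} ,\ \sum_{k=1}^{M} \delta_{\sum_{j=1}^k Y_j} \mathbf{1}_{\{Y_k=1\}} \right),\] where the convergence is convergence in distribution on $\mathcal{M}_F(\{1,2,3,\dots\})^2$.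
   Context: For $\sigma\in S_k$ and $\tau\in S_n$ ($k\le n$), $\tau$ contains the pattern $\sigma$ if there are indices $i_1<\dots<i_k$ with $\tau(i_s)<\tau(i_t)$ iff $\sigma(s)<\sigma(t)$ for all $1\le s<t\le k$; otherwise $\tau$ avoids $\sigma$. $\mathrm{Av}_n(\sigma)$ is the set of $\sigma$-avoiding permutations in $S_n$. A Geometric$(1/2)$ random variable takes values in $\{0,1,2,\dots\}$ with $\mathbb{P}(=k)=2^{-k-1}$. $\delta_x$ denotes the unit point mass at $x$. $\mathcal{M}_F(\{1,2,3,\dots\})$ is the set of finite measures on $\{1,2,3,\dots\}$ with the topology of weak convergence, i.e. the topology generated by the maps $\mu\mapsto\int f\,d\mu$ for all bounded $f:\{1,2,3,\dots\}\to\mathbb{R}$. *)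

theory Defs
  imports "HOL-Analysis.Analysis" "HOL-Probability.Probability"
begin

definition contains_pattern :: "(nat \<Rightarrow> nat) \<Rightarrow> nat \<Rightarrow> (nat \<Rightarrow> nat) \<Rightarrow> nat \<Rightarrow> bool" where
  "contains_pattern \<sigma> k \<tau> n \<longleftrightarrow>
     (\<exists>idx::nat \<Rightarrow> nat. strict_mono_on {1..k} idx \<and> idx ` {1..k} \<subseteq> {1..n} \<and>
        (\<forall>s\<in>{1..k}. \<forall>t\<in>{1..k}. s < t \<longrightarrow> (\<tau> (idx s) < \<tau> (idx t) \<longleftrightarrow> \<sigma> s < \<sigma> t)))"

definition Av :: "nat \<Rightarrow> (nat \<Rightarrow> nat) \<Rightarrow> nat \<Rightarrow> (nat \<Rightarrow> nat) set" where
  "Av n \<sigma> k = {\<tau>. \<tau> permutes {1..n} \<and> \<not> contains_pattern \<sigma> k \<tau> n}"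

definition pat321 :: "nat \<Rightarrow> nat" where
  "pat321 i = (if i = 1 then 3 else if i = 3 then 1 else i)"

text \<open>A finite measure on {1,2,3,...} (all subsets measurable) is represented by its
  mass function w : nat => real, w k = mu {k}, with w 0 = 0 (0 is not in the space).\<close>

definition MF :: "(nat \<Rightarrow> real) set" where
  "MF = {w. (\<forall>k. 0 \<le> w k) \<and> w 0 = 0 \<and> summable w}"

definition mf_integral :: "(nat \<Rightarrow> real) \<Rightarrow> (nat \<Rightarrow> real) \<Rightarrow> real" where
  "mf_integral f w = (\<Sum>k. f k * w k)"

definition MF_top :: "(nat \<Rightarrow> real) topology" where
  "MF_top = topology_generated_by
     {{w \<in> MF. mf_integral f w \<in> U} | f U. bounded (range f) \<and> open U}"

definition delta :: "nat \<Rightarrow> (nat \<Rightarrow> real)" where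
  "delta x = (\<lambda>j. if j = x then 1 else 0)"

definition fix_left :: "nat \<Rightarrow> (nat \<Rightarrow> nat) \<Rightarrow> (nat \<Rightarrow> real)" where
  "fix_left n \<tau> = (\<lambda>x. \<Sum>i\<in>{1..n div 2}. if \<tau> i = i then delta i x else 0)"

definition fix_right :: "nat \<Rightarrow> (nat \<Rightarrow> nat) \<Rightarrow> (nat \<Rightarrow> real)" where
  "fix_right n \<tau> = (\<lambda>x. \<Sum>i\<in>{n div 2 + 1..n}. if \<tau> i = i then delta (n + 1 - i) x else 0)"

definition limit_measure :: "nat \<Rightarrow> (nat \<Rightarrow> nat) \<Rightarrow> (nat \<Rightarrow> real)" where
  "limit_measure N X = (\<lambda>x. \<Sum>k\<in>{1..N}. if X k = 1 then delta (\<Sum>j=1..k. X j) x else 0)"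

definition catalan_law :: "nat \<Rightarrow> real" where
  "catalan_law k = real ((2*k - 2) choose (k - 1)) / (real k * 2 ^ (2*k - 1))"

datatype rv_index = IX nat | IY nat | IN | IM

end

theory Submission
  imports Defs
begin

text \<open>A fixed point of a 321-avoiding permutation splits it as a direct sum \<open>\<alpha> \<oplus> 1 \<oplus> \<beta>\<close>. Hence the number
  of 321-avoiding permutations of \<open>{1..n}\<close> with prescribed fixed points is a product of numbers of
  321-avoiding derangements (the Fine numbers \<open>d\<close>), one factor per gap. Since \<open>C\<^sub>n = 2 d\<^sub>n + d\<^sub>n\<^sub>-\<^sub>1\<close> for the
  Catalan numbers \<open>C\<close> and \<open>C\<^sub>n\<^sub>+\<^sub>1 / C\<^sub>n \<rightarrow> 4\<close>, one has \<open>d\<^sub>n / C\<^sub>n \<rightarrow> 4/9\<close>, so the probability that the fixed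
  points near the two ends are exactly \<open>A\<close> and \<open>B\<close> converges to \<open>p A * p B\<close>, where \<open>p {} = 2/3\<close> and
  a first fixed point at \<open>m\<close> contributes the factor \<open>d\<^sub>m\<^sub>-\<^sub>1 / 4\<^sup>m\<close>. The killed renewal process of the
  limit obeys the same recursion, because the Fine numbers satisfy a renewal equation with the
  Catalan numbers as weights. All laws are carried by the countable set of finite subsets, so this
  pointwise convergence upgrades, by Scheffe's lemma, to convergence in total variation.\<close>

section \<open>Catalan numbers\<close>

text \<open>The constants match for a reason. Dividing \<open>C(n+1) = 2 d(n+1) + d(n)\<close> by
  \<open>C(n+1)\<close> leaves \<open>1 = 2 x + x / 4\<close> for the limit \<open>x\<close> of
  \<open>d(n) / C(n)\<close>, so \<open>x = 4/9\<close>; and \<open>4/9 = (2/3)^2\<close>, as it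
  must be, since with no fixed point prescribed the limit is \<open>p {} * p {}\<close>. On the
  renewal side \<open>2/3\<close> solves \<open>q = 1/2 + q / 4\<close>: stop at once, or survive
  and take a step other than \<open>1\<close>. A step of size \<open>i + 1\<close>, weighted with
  the survival probability \<open>1/2\<close>, counts \<open>C(i) / 4^(i+1)\<close>. Conditioning on
  the first step therefore reproduces \<open>d(k) = \<Sum> C(i) d(k-1-i)\<close> over
  \<open>i \<ge> 1\<close>; the term \<open>i = 0\<close> is absent because a unit step would itself
  mark a fixed point. The two ends decouple one point at a time: with the right-hand set
  \<open>B\<close> frozen, the points of \<open>A\<close> are peeled off from the left, each at the
  cost of an exact factor and a shorter permutation. When \<open>A\<close> is exhausted,
  reverse-complementation turns \<open>B\<close> into a left-hand set.\<close>

definition catalan :: "nat \<Rightarrow> real" where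
  "catalan n = real ((2 * n) choose n) / real (Suc n)"

lemma catalan_0 [simp]: "catalan 0 = 1"
  by (simp add: catalan_def)

lemma catalan_pos: "catalan n > 0"
  by (simp add: catalan_def)

lemma catalan_Suc: "real (n + 2) * catalan (Suc n) = real (4 * n + 2) * catalan n"
proof -
  define x y z where "x = real (Suc (Suc (2 * n)) choose Suc n)"
    and "y = real (Suc (2 * n) choose n)" and "z = real ((2 * n) choose n)"
  have "Suc n * (Suc (Suc (2 * n)) choose Suc n) = Suc (Suc (2 * n)) * (Suc (2 * n) choose n)"
    by (rule Suc_times_binomial)
  then have "real (Suc n) * x = real (Suc (Suc (2 * n))) * y"
    unfolding x_def y_def of_nat_mult[symmetric] by (simp only:)
  then have "real (Suc n) * x = real (Suc n) * (2 * y)" by (simp add: algebra_simps)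
  then have "x = 2 * y" by (simp only: mult_cancel_left) simp
  have "Suc n * (Suc (2 * n) choose n) = Suc (2 * n) * ((2 * n) choose n)"
    using binomial_absorb_comp[of "Suc (2 * n)" n] by simp
  then have "real (Suc n) * y = real (Suc (2 * n)) * z"
    unfolding y_def z_def of_nat_mult[symmetric] by (simp only:)
  moreover have "real (n + 2) * catalan (Suc n) = x" "catalan n = z / real (Suc n)"
    by (simp_all add: catalan_def x_def z_def)
  moreover have "real (4 * n + 2) * (z / real (Suc n)) = 2 * (real (Suc (2 * n)) * z / real (Suc n))"
    by (simp add: algebra_simps add_divide_distrib)
  moreover have "real (Suc n) * y / real (Suc n) = y" by simp
  ultimately show ?thesis using \<open>x = 2 * y\<close> by (simp only:)
qed

text \<open>Both sides obey the two-term recursion of \<open>catalan_Suc\<close>. The left side is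
  the coefficient of \<open>x^(n+1)\<close> in the square root of \<open>1 - 4x\<close>, which makes
  a binomial identity available for the quadratic Catalan recursion.\<close>

lemma catalan_eq_gbinomial: "((1/2 :: real) gchoose Suc n) * (- 4) ^ Suc n = - 2 * catalan n"
proof (induction n)
  case 0
  show ?case by simp
next
  case (Suc n)
  let ?g = "\<lambda>k. (1/2 :: real) gchoose k"
  have "(1/2) * ?g (Suc n) = real (Suc n) * ?g (Suc n) + real (Suc (Suc n)) * ?g (Suc (Suc n))"
    by (rule gbinomial_mult_1)
  then have "real (n + 2) * ?g (Suc (Suc n)) = (1/2 - real (Suc n)) * ?g (Suc n)"
    by (simp add: algebra_simps)
  then have "real (n + 2) * (?g (Suc (Suc n)) * (- 4) ^ Suc (Suc n)) =
      (1/2 - real (Suc n)) * (-4) * (?g (Suc n) * (- 4) ^ Suc n)"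
    by (simp only: power_Suc[of _ "Suc n"] mult.assoc[symmetric])
  also have "\<dots> = - 2 * (real (4 * n + 2) * catalan n)"
    unfolding Suc by (simp add: algebra_simps)
  also have "\<dots> = real (n + 2) * (- 2 * catalan (Suc n))"
    unfolding catalan_Suc[symmetric] by simp
  finally show ?case by (simp only: mult_cancel_left) auto
qed

text \<open>Vandermonde for the square of \<open>(1 - 4x)\<^sup>1\<^sup>/\<^sup>2 = 1 - 2 x C(x)\<close>.\<close>
lemma catalan_convolution: "catalan (Suc n) = (\<Sum>k\<le>n. catalan k * catalan (n - k))"
proof -
  let ?s = "\<lambda>k. ((1/2 :: real) gchoose k) * (- 4) ^ k"
  have "(\<Sum>k\<le>n + 2. ?s k * ?s (n + 2 - k)) =
      (\<Sum>k\<le>n + 2. ((1/2 :: real) gchoose k) * ((1/2) gchoose (n + 2 - k)) * (- 4) ^ (n + 2))"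
  proof (rule sum.cong[OF refl])
    fix k assume "k \<in> {..n + 2}"
    then have "(- 4 :: real) ^ (n + 2) = (- 4) ^ k * (- 4) ^ (n + 2 - k)"
      by (simp add: power_add[symmetric] del: power_Suc)
    then show "?s k * ?s (n + 2 - k) =
        ((1/2 :: real) gchoose k) * ((1/2) gchoose (n + 2 - k)) * (- 4) ^ (n + 2)"
      by (simp only: mult_ac)
  qed
  also have "\<dots> = ((1/2 + 1/2 :: real) gchoose (n + 2)) * (- 4) ^ (n + 2)"
    by (simp only: sum_distrib_right[symmetric] gbinomial_Vandermonde atLeast0AtMost[symmetric])
  \<comment> \<open>The exponents \<open>1/2\<close> add up to \<open>1\<close>, and
    \<open>1 - 4x\<close> has no terms of degree 2 or more.\<close>
  also have "\<dots> = 0"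
    using binomial_gbinomial[of 1 "n + 2", where ?'a = real] by simp
  finally have "(\<Sum>k\<le>n + 2. ?s k * ?s (n + 2 - k)) = 0" .
  moreover have "(\<Sum>k\<le>n + 2. ?s k * ?s (n + 2 - k)) =
      ?s 0 * ?s (n + 2) + (\<Sum>k\<le>n. ?s (Suc k) * ?s (n + 1 - k)) + ?s (n + 2) * ?s 0"
  proof -
    have "(\<Sum>k\<le>Suc (Suc n). f k) = f 0 + (\<Sum>k\<le>n. f (Suc k)) + f (Suc (Suc n))" for f :: "nat \<Rightarrow> real"
      by (subst sum.atMost_Suc, subst sum.atMost_Suc_shift) simp
    from this[of "\<lambda>k. ?s k * ?s (n + 2 - k)"] show ?thesis
      by (simp del: power_Suc sum.atMost_Suc gbinomial_0)
  qed
  moreover have "(\<Sum>k\<le>n. ?s (Suc k) * ?s (n + 1 - k)) = (\<Sum>k\<le>n. 4 * (catalan k * catalan (n - k)))"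
  proof (rule sum.cong[OF refl])
    fix k assume "k \<in> {..n}"
    then have "n + 1 - k = Suc (n - k)" by auto
    then show "?s (Suc k) * ?s (n + 1 - k) = 4 * (catalan k * catalan (n - k))"
      by (simp only: catalan_eq_gbinomial)
  qed
  moreover have "?s (n + 2) = - 2 * catalan (Suc n)" using catalan_eq_gbinomial[of "Suc n"] by simp
  moreover have "?s 0 = 1" by simp
  ultimately show ?thesis by (simp add: sum_distrib_left[symmetric])
qed

text \<open>A contraction with vanishing perturbation forgets its start geometrically. It is applied
  to the error of the ratio of Fine to Catalan numbers.\<close>

lemma tendsto_zero_contraction:
  fixes e \<delta> :: "nat \<Rightarrow> real"
  assumes rec: "\<And>n. \<bar>e (Suc n)\<bar> \<le> \<delta> n + c * \<bar>e n\<bar>" and c: "0 \<le> c" "c < 1"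
    and \<delta>: "\<delta> \<longlonglongrightarrow> 0"
  shows "e \<longlonglongrightarrow> 0"
proof (rule LIMSEQ_I)
  fix \<epsilon> :: real assume \<epsilon>: "0 < \<epsilon>"
  define \<eta> where "\<eta> = \<epsilon> / 2"
  have \<eta>: "0 < \<eta>" using \<epsilon> by (simp add: \<eta>_def)
  \<comment> \<open>The threshold \<open>\<eta> * (1 - c)\<close> makes \<open>\<eta>\<close> a
    fixed point of the map sending \<open>x\<close> to \<open>\<eta> * (1 - c) + c * x\<close>, so
    the bound below reproduces itself.\<close>
  have "0 < \<eta> * (1 - c)" using \<eta> c by simp
  then obtain n0 where n0: "\<And>n. n \<ge> n0 \<Longrightarrow> \<delta> n \<le> \<eta> * (1 - c)"
    using LIMSEQ_D[OF \<delta>] by (metis abs_le_D1 diff_zero less_imp_le real_norm_def)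
  have bound: "\<bar>e (n0 + k)\<bar> \<le> \<eta> + c ^ k * \<bar>e n0\<bar>" for k
  proof (induction k)
    case (Suc k)
    have "\<bar>e (n0 + Suc k)\<bar> \<le> \<delta> (n0 + k) + c * \<bar>e (n0 + k)\<bar>" using rec by simp
    also have "\<dots> \<le> \<eta> * (1 - c) + c * (\<eta> + c ^ k * \<bar>e n0\<bar>)"
      using n0[of "n0 + k"] Suc c by (intro add_mono mult_left_mono) auto
    also have "\<dots> = \<eta> + c ^ Suc k * \<bar>e n0\<bar>" by (simp add: algebra_simps)
    finally show ?case .
  qed (use \<eta> in simp)
  have "(\<lambda>k. c ^ k * \<bar>e n0\<bar>) \<longlonglongrightarrow> 0"
    using c by (intro tendsto_mult_left_zero LIMSEQ_realpow_zero)
  from LIMSEQ_D[OF this \<eta>] obtain k0 where k0: "\<And>k. k \<ge> k0 \<Longrightarrow> c ^ k * \<bar>e n0\<bar> < \<eta>"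
    by (metis abs_less_iff diff_zero real_norm_def)
  show "\<exists>no. \<forall>n\<ge>no. norm (e n - 0) < \<epsilon>"
  proof (intro exI allI impI)
    fix n assume "n \<ge> n0 + k0"
    then have "n = n0 + (n - n0)" "n - n0 \<ge> k0" by auto
    then show "norm (e n - 0) < \<epsilon>"
      using bound[of "n - n0"] k0[of "n - n0"] by (simp add: \<eta>_def)
  qed
qed

lemma catalan_ratio: "catalan n / catalan (Suc n) = real (n + 2) / real (4 * n + 2)"
proof -
  have nz: "catalan (Suc n) \<noteq> 0" "real (4 * n + 2) \<noteq> 0" using catalan_pos[of "Suc n"] by simp_all
  have "catalan n * real (4 * n + 2) = real (n + 2) * catalan (Suc n)"
    unfolding catalan_Suc by (rule mult.commute)
  then show ?thesis by (rule iffD2[OF frac_eq_eq[OF nz]])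
qed

lemma catalan_ratio_tendsto: "(\<lambda>n. catalan n / catalan (Suc n)) \<longlonglongrightarrow> 1/4"
proof -
  have "filterlim (\<lambda>n. 1/2 + real n) at_top sequentially"
    by (rule filterlim_tendsto_add_at_top[OF tendsto_const filterlim_real_sequentially])
  then have "(\<lambda>n. inverse (1/2 + real n)) \<longlonglongrightarrow> 0"
    by (rule filterlim_compose[OF tendsto_inverse_0_at_top[OF filterlim_ident]])
  \<comment> \<open>Division with remainder of \<open>n + 2\<close> by \<open>4 n + 2\<close> gives
    this form of the ratio.\<close>
  then have "(\<lambda>n. 1/4 + (3/8) * inverse (1/2 + real n)) \<longlonglongrightarrow> 1/4 + (3/8) * 0"
    by (intro tendsto_intros)
  moreover have "1/4 + (3/8) * inverse (1/2 + real n) = catalan n / catalan (Suc n)" for n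
    unfolding catalan_ratio by (simp add: field_simps)
  ultimately show ?thesis by simp
qed

lemma catalan_shift_ratio_tendsto: "(\<lambda>n. catalan n / catalan (n + m)) \<longlonglongrightarrow> (1/4) ^ m"
proof (induction m)
  case 0
  have "catalan n \<noteq> 0" for n using catalan_pos[of n] by simp
  then show ?case by simp
next
  case (Suc m)
  have "(\<lambda>n. catalan (n + m) / catalan (Suc (n + m))) \<longlonglongrightarrow> 1/4"
    using LIMSEQ_ignore_initial_segment[OF catalan_ratio_tendsto, of m] by simp
  from tendsto_mult[OF Suc this] show ?case
    using catalan_pos by (simp add: less_imp_neq[symmetric])
qed

text \<open>The law is that of half the first return time of simple random walk. Its tail is the
  central binomial probability \<open>(2n choose n) / 4^n\<close>, and the sum telescopes.\<close>

lemma sum_catalan_law: "(\<Sum>k<Suc n. catalan_law k) = 1 - real (Suc n) * catalan n / 4 ^ n"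
proof (induction n)
  case 0
  show ?case by (simp add: catalan_law_def)
next
  case (Suc n)
  have "catalan_law (Suc n) = catalan n / (2 * 4 ^ n)"
  proof -
    have "(2 :: real) ^ (2 * Suc n - 1) = 2 * 4 ^ n" by (simp add: power_mult)
    then show ?thesis by (simp add: catalan_law_def catalan_def mult.commute)
  qed
  moreover have "real (Suc (Suc n)) * catalan (Suc n) = real (4 * n + 2) * catalan n"
    using catalan_Suc[of n] by simp
  ultimately show ?case using Suc
    by (simp add: field_simps)
qed

text \<open>A step multiplies the tail by \<open>(2n+1) / (2n+2)\<close>, and
  \<open>(2n+1) * (2n+3) \<le> (2n+2)^2\<close> closes the induction for its square. This gives the
  decay that makes \<open>catalan_law\<close> a probability law without Stirling's formula.\<close>

lemma central_binomial_square_le: "(real (Suc n) * catalan n / 4 ^ n)\<^sup>2 \<le> 1 / real (2 * n + 1)"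
proof (induction n)
  case (Suc n)
  let ?u = "\<lambda>n. real (Suc n) * catalan n / 4 ^ n"
  have "?u (Suc n) = ?u n * (real (2 * n + 1) / real (2 * n + 2))"
  proof -
    have "?u (Suc n) = (real (n + 2) * catalan (Suc n)) / 4 ^ Suc n" by simp
    also have "\<dots> = real (4 * n + 2) * catalan n / 4 ^ Suc n" unfolding catalan_Suc ..
    also have "\<dots> = ?u n * (real (2 * n + 1) / real (2 * n + 2))"
      by (simp add: divide_simps) (simp add: algebra_simps)
    finally show ?thesis .
  qed
  then have "(?u (Suc n))\<^sup>2 = (?u n)\<^sup>2 * (real (2 * n + 1) / real (2 * n + 2))\<^sup>2"
    by (simp only: power_mult_distrib)
  also have "\<dots> \<le> 1 / real (2 * n + 1) * (real (2 * n + 1) / real (2 * n + 2))\<^sup>2"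
    by (intro mult_right_mono Suc) auto
  also have "\<dots> \<le> 1 / real (2 * Suc n + 1)"
    by (simp add: divide_simps power2_eq_square) (simp add: algebra_simps)
  finally show ?case .
qed simp

lemma catalan_law_sums: "catalan_law sums 1"
proof -
  let ?u = "\<lambda>n. real (Suc n) * catalan n / 4 ^ n"
  have "(?u n)\<^sup>2 \<le> inverse (real (Suc n))" for n
  proof -
    have "1 / real (2 * n + 1) \<le> inverse (real (Suc n))" by (simp add: divide_simps)
    then show ?thesis using central_binomial_square_le[of n] by linarith
  qed
  then have "\<forall>\<^sub>F n in sequentially. (?u n)\<^sup>2 \<le> inverse (real (Suc n))"
    by (intro always_eventually allI)
  moreover have "\<forall>\<^sub>F n in sequentially. 0 \<le> (?u n)\<^sup>2"
    by (intro always_eventually allI zero_le_power2)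
  ultimately have "(\<lambda>n. (?u n)\<^sup>2) \<longlonglongrightarrow> 0"
    by (intro tendsto_sandwich[OF _ _ tendsto_const LIMSEQ_inverse_real_of_nat])
  then have "?u \<longlonglongrightarrow> 0" by (simp only: power_tendsto_0_iff zero_less_numeral)
  then have "(\<lambda>n. 1 - ?u n) \<longlonglongrightarrow> 1 - 0" by (intro tendsto_intros)
  then have "(\<lambda>n. \<Sum>k<Suc n. catalan_law k) \<longlonglongrightarrow> 1" by (simp only: sum_catalan_law diff_zero)
  then show ?thesis unfolding sums_def by (rule LIMSEQ_imp_Suc)
qed

section \<open>Generating functions: Fine numbers against Catalan numbers\<close>

lemma fps_catalan: "Abs_fps catalan = 1 + fps_X * (Abs_fps catalan * Abs_fps catalan)"
proof (rule fps_ext)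
  fix n
  show "fps_nth (Abs_fps catalan) n =
      fps_nth (1 + fps_X * (Abs_fps catalan * Abs_fps catalan)) n"
  proof (cases n)
    case (Suc m)
    have "fps_nth (Abs_fps catalan * Abs_fps catalan) m = catalan (Suc m)"
      unfolding fps_mult_nth atLeast0AtMost catalan_convolution by simp
    then show ?thesis by (simp add: Suc)
  qed simp
qed

context
  fixes d :: "nat \<Rightarrow> real"
  assumes first: "\<And>n. catalan n = d n + (\<Sum>i<n. d i * catalan (n - 1 - i))"
begin

text \<open>Here \<open>d\<close> stands for the fixed-point-free counts: \<open>first\<close> cuts
  at the smallest fixed point \<open>i + 1\<close>, behind which a permutation of size
  \<open>n - 1 - i\<close> is unrestricted.\<close>

lemma fps_first: "Abs_fps d * (1 + fps_X * Abs_fps catalan) = Abs_fps catalan"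
proof (rule fps_ext)
  fix n
  have "fps_nth (fps_X * (Abs_fps d * Abs_fps catalan)) n = (\<Sum>i<n. d i * catalan (n - 1 - i))"
  proof (cases n)
    case (Suc m)
    then have "fps_nth (fps_X * (Abs_fps d * Abs_fps catalan)) n =
        fps_nth (Abs_fps d * Abs_fps catalan) m" by simp
    also have "\<dots> = (\<Sum>i<n. d i * catalan (n - 1 - i))"
      unfolding fps_mult_nth Suc lessThan_Suc_atMost atLeast0AtMost by simp
    finally show ?thesis .
  qed simp
  moreover have "Abs_fps d * (1 + fps_X * Abs_fps catalan) =
      Abs_fps d + fps_X * (Abs_fps d * Abs_fps catalan)" by (simp add: algebra_simps)
  ultimately show "fps_nth (Abs_fps d * (1 + fps_X * Abs_fps catalan)) n = fps_nth (Abs_fps catalan) n"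
    using first[of n] by (simp only: fps_add_nth fps_nth_Abs_fps)
qed

text \<open>Power series over the reals form an integral domain, so this allows the common factor
  \<open>1 + x C\<close> to be cancelled in the two identities below.\<close>

lemma fps_one_plus_neq_0: "1 + fps_X * Abs_fps catalan \<noteq> 0"
proof
  assume "1 + fps_X * Abs_fps catalan = 0"
  then have "fps_nth (1 + fps_X * Abs_fps catalan) 0 = fps_nth 0 0" by (rule arg_cong)
  then show False by simp
qed

lemma catalan_eq_fine: "catalan (Suc n) = 2 * d (Suc n) + d n"
proof -
  let ?C = "Abs_fps catalan" and ?D = "Abs_fps d"
  have "(2 + fps_X) * ?D * (1 + fps_X * ?C) = (2 + fps_X) * ?C"
    by (simp only: mult.assoc fps_first)
  \<comment> \<open>Only one of the two copies of \<open>C\<close> is expanded by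
    \<open>C = 1 + x C^2\<close>; that exposes the factor \<open>1 + x C\<close>.\<close>
  also have "\<dots> = ?C + (1 + fps_X * (?C * ?C)) + (fps_X * ?C)"
    by (simp only: fps_catalan[symmetric]) (simp add: algebra_simps)
  also have "\<dots> = (?C + 1) * (1 + fps_X * ?C)" by (simp add: algebra_simps)
  finally have "(2 + fps_X) * ?D = ?C + 1" using fps_one_plus_neq_0 by simp
  then have "fps_nth ((2 + fps_X) * ?D) (Suc n) = fps_nth (?C + 1) (Suc n)"
    by (simp only:)
  then show ?thesis by (simp add: distrib_right numeral_fps_const)
qed

text \<open>In series form \<open>D = 1 + x (C - 1) D\<close>, verified after multiplication by
  \<open>1 + x C\<close>. Subtracting \<open>1\<close> from \<open>C\<close> is what removes the
  term \<open>i = 0\<close>.\<close>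

lemma fine_renewal: "d (Suc n) = (\<Sum>i=1..n. catalan i * d (n - i))"
proof -
  let ?C = "Abs_fps catalan" and ?D = "Abs_fps d"
  have "(1 + fps_X * ((?C - 1) * ?D)) * (1 + fps_X * ?C) =
      1 + fps_X * ?C + fps_X * (?C - 1) * (?D * (1 + fps_X * ?C))"
    by (simp only: distrib_right mult_1_left mult.assoc)
  also have "\<dots> = 1 + fps_X * (?C * ?C)" unfolding fps_first by (simp add: algebra_simps)
  also have "\<dots> = ?D * (1 + fps_X * ?C)" unfolding fps_first by (rule fps_catalan[symmetric])
  finally have "1 + fps_X * ((?C - 1) * ?D) = ?D" using fps_one_plus_neq_0 by simp
  then have "fps_nth (1 + fps_X * ((?C - 1) * ?D)) (Suc n) = fps_nth ?D (Suc n)"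
    by (simp only:)
  then have "d (Suc n) = fps_nth ((?C - 1) * ?D) n" by (simp only: fps_add_nth fps_X_mult_nth fps_nth_Abs_fps fps_one_nth) simp
  also have "\<dots> = (\<Sum>i=0..n. fps_nth (?C - 1) i * d (n - i))" by (simp only: fps_mult_nth fps_nth_Abs_fps)
  also have "\<dots> = (\<Sum>i=1..n. fps_nth (?C - 1) i * d (n - i))" by (subst sum.atLeast_Suc_atMost) auto
  also have "\<dots> = (\<Sum>i=1..n. catalan i * d (n - i))" by (intro sum.cong) auto
  finally show ?thesis .
qed

text \<open>Dividing \<open>catalan_eq_fine\<close> by \<open>catalan (Suc n)\<close> gives an
  affine recursion with fixed point \<open>4/9\<close> at \<open>\<rho> = 1/4\<close>. The error is
  multiplied by \<open>- \<rho> / 2\<close>, at most \<open>1/2\<close> in size since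
  \<open>\<rho> \<le> 1\<close>, and the perturbation vanishes as \<open>\<rho>\<close> tends to
  \<open>1/4\<close>.\<close>

lemma fine_ratio_tendsto: "(\<lambda>n. d n / catalan n) \<longlonglongrightarrow> 4/9"
proof -
  let ?\<rho> = "\<lambda>n. catalan n / catalan (Suc n)"
  define e where "e = (\<lambda>n. d n / catalan n - 4/9)"
  have rec: "e (Suc n) = 2/9 * (1/4 - ?\<rho> n) - ?\<rho> n / 2 * e n" for n
  proof -
    have "2 * (d (Suc n) / catalan (Suc n)) + (d n / catalan n) * ?\<rho> n = 1"
    proof -
      have "(d n / catalan n) * ?\<rho> n = d n / catalan (Suc n)" using catalan_pos[of n] by simp
      then have "2 * (d (Suc n) / catalan (Suc n)) + (d n / catalan n) * ?\<rho> n =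
          (2 * d (Suc n) + d n) / catalan (Suc n)" by (simp only: add_divide_distrib times_divide_eq_right)
      then show ?thesis using catalan_pos[of "Suc n"] by (simp only: catalan_eq_fine[symmetric]) simp
    qed
    moreover have "b - 4/9 = 2/9 * (1/4 - \<rho>) - \<rho> / 2 * (a - 4/9)"
      if "2 * b + a * \<rho> = 1" for a b \<rho> :: real
    proof -
      define p where "p = a * \<rho>"
      have "b - 4/9 = (1/18 - 2/9 * \<rho>) - (p / 2 - 2/9 * \<rho>)"
        using that unfolding p_def[symmetric] by linarith
      also have "1/18 - 2/9 * \<rho> = 2/9 * (1/4 - \<rho>)" by (simp add: field_simps)
      also have "p / 2 - 2/9 * \<rho> = \<rho> / 2 * (a - 4/9)" by (simp add: p_def field_simps)
      finally show ?thesis .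
    qed
    ultimately show ?thesis unfolding e_def by blast
  qed
  have \<rho>: "0 \<le> ?\<rho> n" "?\<rho> n \<le> 1" for n unfolding catalan_ratio by auto
  have "e \<longlonglongrightarrow> 0"
  proof (rule tendsto_zero_contraction)
    show "\<bar>e (Suc n)\<bar> \<le> \<bar>2/9 * (1/4 - ?\<rho> n)\<bar> + 1/2 * \<bar>e n\<bar>" for n
    proof -
      have "\<bar>?\<rho> n / 2 * e n\<bar> \<le> 1/2 * \<bar>e n\<bar>"
        unfolding abs_mult using \<rho>[of n] by (intro mult_right_mono) auto
      then show ?thesis unfolding rec by (rule order_trans[OF abs_triangle_ineq4 add_left_mono])
    qed
    have "(\<lambda>n. \<bar>2/9 * (1/4 - ?\<rho> n)\<bar>) \<longlonglongrightarrow> \<bar>2/9 * (1/4 - 1/4)\<bar>"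
      by (intro tendsto_intros catalan_ratio_tendsto)
    then show "(\<lambda>n. \<bar>2/9 * (1/4 - ?\<rho> n)\<bar>) \<longlonglongrightarrow> 0" by simp
  qed auto
  then show ?thesis unfolding e_def by (simp add: LIM_zero_iff)
qed

end

section \<open>Counting 321-avoiding permutations\<close>

text \<open>A head \<open>x\<close> plays the 3 of a pattern 321 exactly if the later entries below
  \<open>x\<close> contain a descent. The recursive form suits inductions over insertion and
  concatenation.\<close>

fun no321 :: "nat list \<Rightarrow> bool" where
  "no321 [] \<longleftrightarrow> True"
| "no321 (x # xs) \<longleftrightarrow> sorted (filter (\<lambda>y. y < x) xs) \<and> no321 xs"

lemma sorted_filter_less_iff:
  "sorted (filter (\<lambda>y. y < x) xs) \<longleftrightarrow>
     (\<forall>j k. j < k \<and> k < length xs \<longrightarrow> \<not> (x > xs ! j \<and> xs ! j > xs ! k))" for x :: nat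
proof (induction xs)
  case (Cons a xs)
  have "(\<forall>j k. j < k \<and> k < length (a # xs) \<longrightarrow> \<not> (x > (a # xs) ! j \<and> (a # xs) ! j > (a # xs) ! k)) \<longleftrightarrow>
        (\<forall>k < length xs. \<not> (x > a \<and> a > xs ! k)) \<and>
        (\<forall>j k. j < k \<and> k < length xs \<longrightarrow> \<not> (x > xs ! j \<and> xs ! j > xs ! k))" (is "?l \<longleftrightarrow> ?r")
  proof
    assume l: ?l
    show ?r
    proof (intro conjI allI impI)
      fix k assume "k < length xs"
      then show "\<not> (x > a \<and> a > xs ! k)" using l[rule_format, of 0 "Suc k"] by simp
    next
      fix j k assume "j < k \<and> k < length xs"
      then show "\<not> (x > xs ! j \<and> xs ! j > xs ! k)" using l[rule_format, of "Suc j" "Suc k"] by simp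
    qed
  next
    assume ?r
    then show ?l
      by (auto simp: nth_Cons split: nat.splits)
  qed
  moreover have "(\<forall>k < length xs. \<not> (x > a \<and> a > xs ! k)) \<longleftrightarrow> (a < x \<longrightarrow> (\<forall>y\<in>set xs. y < x \<longrightarrow> a \<le> y))"
    by (auto simp: all_set_conv_all_nth)
  ultimately show ?case using Cons.IH by auto
qed simp

lemma no321_iff_nth:
  "no321 xs \<longleftrightarrow>
     (\<forall>i j k. i < j \<and> j < k \<and> k < length xs \<longrightarrow> \<not> (xs ! i > xs ! j \<and> xs ! j > xs ! k))"
proof (induction xs)
  case (Cons a xs)
  have "(\<forall>i j k. i < j \<and> j < k \<and> k < length (a # xs) \<longrightarrow>
           \<not> ((a # xs) ! i > (a # xs) ! j \<and> (a # xs) ! j > (a # xs) ! k)) \<longleftrightarrow>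
        (\<forall>j k. j < k \<and> k < length xs \<longrightarrow> \<not> (a > xs ! j \<and> xs ! j > xs ! k)) \<and>
        (\<forall>i j k. i < j \<and> j < k \<and> k < length xs \<longrightarrow> \<not> (xs ! i > xs ! j \<and> xs ! j > xs ! k))"
    (is "?l \<longleftrightarrow> ?r")
  proof
    assume l: ?l
    show ?r
    proof (intro conjI allI impI)
      fix j k assume "j < k \<and> k < length xs"
      then show "\<not> (a > xs ! j \<and> xs ! j > xs ! k)" using l[rule_format, of 0 "Suc j" "Suc k"] by simp
    next
      fix i j k assume "i < j \<and> j < k \<and> k < length xs"
      then show "\<not> (xs ! i > xs ! j \<and> xs ! j > xs ! k)"
        using l[rule_format, of "Suc i" "Suc j" "Suc k"] by simp
    qed
  next
    assume r: ?r
    show ?l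
    proof (intro allI impI)
      fix i j k assume *: "i < j \<and> j < k \<and> k < length (a # xs)"
      then obtain j' k' where "j = Suc j'" "k = Suc k'" by (metis less_nat_zero_code not0_implies_Suc)
      then show "\<not> ((a # xs) ! i > (a # xs) ! j \<and> (a # xs) ! j > (a # xs) ! k)"
        using * r by (cases i) auto
    qed
  qed
  then show ?case using Cons.IH sorted_filter_less_iff[of a xs] by simp
qed simp

text \<open>A maximum can only play the 3, so it constrains just what follows it; the tests made at
  earlier heads filter it out.\<close>

lemma no321_insert_max:
  assumes "\<forall>y\<in>set (ys @ zs). y < N"
  shows "no321 (ys @ N # zs) \<longleftrightarrow> no321 (ys @ zs) \<and> sorted zs"
  using assms
proof (induction ys)
  case Nil
  then have "filter (\<lambda>y. y < N) zs = zs" by (simp add: filter_id_conv)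
  moreover have "sorted zs \<Longrightarrow> no321 zs" for zs
    by (induction zs) (auto simp: sorted_wrt_filter)
  ultimately show ?case by auto
next
  case (Cons a ys)
  then have "filter (\<lambda>y. y < a) (ys @ N # zs) = filter (\<lambda>y. y < a) (ys @ zs)" by auto
  then show ?case using Cons by auto
qed

text \<open>No inversion crosses the boundary, so a 321 lies inside one block.\<close>

lemma no321_append_less:
  assumes "\<forall>y\<in>set ys. \<forall>z\<in>set zs. y < z"
  shows "no321 (ys @ zs) \<longleftrightarrow> no321 ys \<and> no321 zs"
  using assms
proof (induction ys)
  case (Cons a ys)
  then have "filter (\<lambda>y. y < a) (ys @ zs) = filter (\<lambda>y. y < a) ys"
    by (auto simp: filter_empty_conv)
  then show ?case using Cons by auto
qed simp

lemma no321_map_add: "no321 (map ((+) m) zs) \<longleftrightarrow> no321 zs"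
  by (simp add: no321_iff_nth)

lemma no321_straddle:
  assumes "no321 (ys @ m # zs)" "y \<in> set ys" "m < y" "z \<in> set zs"
  shows "m \<le> z"
  using assms
proof (induction ys)
  case (Cons a ys)
  show ?case
  proof (cases "y = a")
    case True
    then have "sorted (filter (\<lambda>y. y < a) ys @ m # filter (\<lambda>y. y < a) zs)"
      using Cons.prems by simp
    then have "z < a \<longrightarrow> m \<le> z" using Cons.prems by (auto simp: sorted_append)
    then show ?thesis using Cons.prems True by linarith
  qed (use Cons in auto)
qed simp

section \<open>Enumeration of 321-avoiders by ballot numbers\<close>

definition perms321 :: "nat \<Rightarrow> nat list set" where
  "perms321 n = {xs. distinct xs \<and> set xs = {1..n} \<and> no321 xs}"

lemma perms321_length: "xs \<in> perms321 n \<Longrightarrow> length xs = n"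
  unfolding perms321_def using distinct_card[of xs] by simp

lemma finite_perms321 [simp]: "finite (perms321 n)"
  by (rule finite_subset[OF _ finite_subset_distinct[of "{1..n}"]]) (auto simp: perms321_def)

lemma perms321_nonempty [simp]: "perms321 n \<noteq> {}"
proof -
  have "no321 [1..<Suc n]" by (auto simp: no321_iff_nth simp del: upt_Suc)
  then have "[1..<Suc n] \<in> perms321 n" by (auto simp: perms321_def simp del: upt_Suc)
  then show ?thesis by blast
qed

lemma perms321_0 [simp]: "perms321 0 = {[]}"
  by (auto simp: perms321_def)

text \<open>The new maximum can be inserted into a 321-avoiding permutation exactly in front of an increasing
  suffix, so counting by the length of that suffix gives the recursion of the ballot numbers.\<close>
definition tail_sorted321 :: "nat \<Rightarrow> nat \<Rightarrow> nat list set" where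
  "tail_sorted321 n j = {xs \<in> perms321 n. sorted (drop (n - j) xs)}"

lemma insert_max_mem_perms321:
  assumes "set (ys @ zs) = {1..n}"
  shows "ys @ Suc n # zs \<in> perms321 (Suc n) \<longleftrightarrow> ys @ zs \<in> perms321 n \<and> sorted zs"
proof -
  have "\<forall>y\<in>set (ys @ zs). y < Suc n" using assms by auto
  note max = no321_insert_max[OF this]
  have "Suc n \<notin> set (ys @ zs)" unfolding assms by simp
  then have "distinct (ys @ Suc n # zs) \<longleftrightarrow> distinct (ys @ zs)" by auto
  have "set (ys @ Suc n # zs) = insert (Suc n) (set (ys @ zs))" by auto
  moreover have "insert (Suc n) {1..n} = {1..Suc n}" by auto
  ultimately have "set (ys @ Suc n # zs) = {1..Suc n}" unfolding assms by (simp only:)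
  with \<open>distinct (ys @ Suc n # zs) \<longleftrightarrow> _\<close> max assms show ?thesis
    unfolding perms321_def mem_Collect_eq by blast
qed

lemma perms321_SucE:
  assumes "xs \<in> perms321 (Suc n)"
  obtains ys zs where "xs = ys @ Suc n # zs" "ys @ zs \<in> perms321 n" "sorted zs"
proof -
  have "Suc n \<in> set xs" using assms by (auto simp: perms321_def)
  then obtain ys zs where x: "xs = ys @ Suc n # zs" by (auto dest: split_list)
  have "set xs = {1..Suc n}" "distinct xs" using assms by (auto simp: perms321_def)
  then have "set (ys @ zs) = {1..Suc n} - {Suc n}" unfolding x by auto
  moreover have "{1..Suc n} - {Suc n} = {1..n}" by auto
  ultimately have "set (ys @ zs) = {1..n}" by (simp only:)
  from insert_max_mem_perms321[OF this] assms x that show ?thesis by blast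
qed

text \<open>The parameter \<open>i\<close> counts the entries to the right of the new maximum,
  matching the length of the suffix that must be sorted.\<close>

definition insert_max :: "nat \<Rightarrow> nat \<Rightarrow> nat list \<Rightarrow> nat list" where
  "insert_max n i xs = take (n - i) xs @ Suc n # drop (n - i) xs"

text \<open>A maximum in last place (\<open>i = 0\<close>) leaves \<open>j - 1\<close> old entries
  to be sorted. With \<open>i \<ge> j\<close> entries behind it, the last \<open>j\<close> lie in a
  suffix that insertion already requires to be sorted. For \<open>0 < i < j\<close> it would stand
  inside the last \<open>j\<close> entries but not at their end, breaking the order.\<close>

lemma tail_sorted321_Suc:
  assumes "1 \<le> j" "j \<le> Suc n"
  shows "tail_sorted321 (Suc n) j =
    insert_max n 0 ` tail_sorted321 n (j - 1) \<union> (\<Union>i\<in>{j..n}. insert_max n i ` tail_sorted321 n i)"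
    (is "?L = ?A \<union> ?B")
proof (intro equalityI subsetI)
  fix xs assume xs: "xs \<in> ?L"
  then obtain ys zs where e: "xs = ys @ Suc n # zs" and m: "ys @ zs \<in> perms321 n" and s: "sorted zs"
    by (auto simp: tail_sorted321_def elim: perms321_SucE)
  have l: "length ys + length zs = n" using perms321_length[OF m] by simp
  have ins: "xs = insert_max n (length zs) (ys @ zs)"
    using l by (auto simp: e insert_max_def)
  have mem: "ys @ zs \<in> tail_sorted321 n (length zs)" using m s l by (auto simp: tail_sorted321_def)
  have xd: "sorted (drop (Suc n - j) xs)" using xs by (simp add: tail_sorted321_def)
  show "xs \<in> ?A \<union> ?B"
  proof (cases "zs = []")
    case True
    have 1: "Suc n - j = n - (j - 1)" using assms by linarith
    have "drop (n - (j - 1)) (ys @ [Suc n]) = drop (n - (j - 1)) ys @ [Suc n]" using l True by simp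
    then have "drop (Suc n - j) xs = drop (n - (j - 1)) ys @ [Suc n]" by (simp only: e True 1)
    then have "sorted (drop (n - (j - 1)) ys)" using xd by (simp add: sorted_append)
    then have "ys @ zs \<in> tail_sorted321 n (j - 1)" using m True by (auto simp: tail_sorted321_def)
    then show ?thesis using ins True by auto
  next
    case False
    have "j \<le> length zs"
    proof (rule ccontr)
      \<comment> \<open>Now the maximum is among the last \<open>j\<close> entries, so
        \<open>Suc n # zs\<close> would be sorted although \<open>zs\<close> has smaller
        entries.\<close>
      assume "\<not> j \<le> length zs"
      then have "Suc n - j - length ys = 0" using l by linarith
      then have "drop (Suc n - j) xs = drop (Suc n - j) ys @ Suc n # zs"
        by (simp only: e drop_append drop_0)
      then have "sorted (Suc n # zs)" using xd by (simp only: sorted_append)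
      moreover have "\<forall>z\<in>set zs. z \<le> n" using m by (auto simp: perms321_def)
      ultimately show False using False by (cases zs) auto
    qed
    then have "length zs \<in> {j..n}" using l by simp
    then show ?thesis using ins mem by blast
  qed
next
  fix xs assume "xs \<in> ?A \<union> ?B"
  then consider (a) ys where "ys \<in> tail_sorted321 n (j - 1)" "xs = insert_max n 0 ys"
    | (b) i ys where "i \<in> {j..n}" "ys \<in> tail_sorted321 n i" "xs = insert_max n i ys" by auto
  then show "xs \<in> ?L"
  proof cases
    case a
    then have l: "length ys = n" and st: "set ys = {1..n}"
      by (auto simp: tail_sorted321_def perms321_length) (auto simp: perms321_def)
    have "xs = ys @ Suc n # []" using a l by (simp add: insert_max_def)
    moreover have "ys @ Suc n # [] \<in> perms321 (Suc n)"
      using a st by (subst insert_max_mem_perms321) (auto simp: tail_sorted321_def)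
    moreover have "sorted (drop (Suc n - j) (ys @ Suc n # []))"
    proof -
      have 1: "Suc n - j = n - (j - 1)" using assms by linarith
      have "drop (n - (j - 1)) (ys @ [Suc n]) = drop (n - (j - 1)) ys @ [Suc n]" using l by simp
      then have "drop (Suc n - j) (ys @ Suc n # []) = drop (n - (j - 1)) ys @ [Suc n]"
        by (simp only: 1)
      moreover have "\<forall>y\<in>set (drop (n - (j - 1)) ys). y \<le> Suc n"
        using st by (auto dest: in_set_dropD)
      ultimately show ?thesis using a by (simp add: tail_sorted321_def sorted_append)
    qed
    ultimately show ?thesis by (simp add: tail_sorted321_def)
  next
    case b
    then have l: "length ys = n" and st: "set ys = {1..n}"
      by (auto simp: tail_sorted321_def perms321_length) (auto simp: perms321_def)
    have "set (take (n - i) ys @ drop (n - i) ys) = {1..n}" using st by simp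
    then have "xs \<in> perms321 (Suc n)" unfolding b insert_max_def
      by (subst insert_max_mem_perms321) (use b in \<open>auto simp: tail_sorted321_def\<close>)
    moreover have "drop (Suc n - j) xs = drop (i - j) (drop (n - i) ys)"
    proof -
      have 1: "Suc n - j = Suc ((n - i) + (i - j))" using b assms by auto
      have "length (take (n - i) ys) = n - i" using l by simp
      then show ?thesis unfolding b insert_max_def 1 by simp
    qed
    ultimately show ?thesis using b by (simp add: tail_sorted321_def sorted_wrt_drop del: drop_drop)
  qed
qed

lemma insert_max_inject:
  assumes "xs \<in> perms321 n" "ys \<in> perms321 n" "i \<le> n" "k \<le> n"
    and "insert_max n i xs = insert_max n k ys"
  shows "i = k \<and> xs = ys"
proof -
  have l: "length xs = n" "length ys = n" using assms by (auto simp: perms321_length)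
  have "Suc n \<notin> set xs" "Suc n \<notin> set ys" using assms by (auto simp: perms321_def)
  then have "Suc n \<notin> set (take (n-i) xs)" "Suc n \<notin> set (take (n-k) ys)"
    "Suc n \<notin> set (drop (n-i) xs)" "Suc n \<notin> set (drop (n-k) ys)"
    by (meson in_set_takeD in_set_dropD)+
  then have e: "take (n-i) xs = take (n-k) ys" "drop (n-i) xs = drop (n-k) ys"
    using assms(5) by (auto simp: insert_max_def append_Cons_eq_iff)
  then have "length (take (n-i) xs) = length (take (n-k) ys)" by simp
  then have "i = k" using l assms by simp
  moreover have "xs = ys" using e by (metis append_take_drop_id)
  ultimately show ?thesis by simp
qed

lemma card_tail_sorted321_Suc:
  assumes "1 \<le> j" "j \<le> Suc n"
  shows "card (tail_sorted321 (Suc n) j) =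
    card (tail_sorted321 n (j - 1)) + (\<Sum>i=j..n. card (tail_sorted321 n i))"
proof -
  have sub: "tail_sorted321 n i \<subseteq> perms321 n" for i by (auto simp: tail_sorted321_def)
  have fin: "finite (tail_sorted321 n i)" for i by (rule finite_subset[OF sub]) simp
  have ci: "card (insert_max n i ` tail_sorted321 n k) = card (tail_sorted321 n k)" if "i \<le> n" for i k
    by (rule card_image, rule inj_onI) (use insert_max_inject that sub in blast)
  have dis: "insert_max n i ` tail_sorted321 n k \<inter> insert_max n i' ` tail_sorted321 n k' = {}"
    if "i \<le> n" "i' \<le> n" "i \<noteq> i'" for i i' k k'
    using insert_max_inject that sub by blast
  have "insert_max n 0 ` tail_sorted321 n (j - 1) \<inter> insert_max n i ` tail_sorted321 n i = {}"
    if "i \<in> {j..n}" for i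
    using dis[of 0 i "j - 1" i] that assms by simp
  then have d0: "insert_max n 0 ` tail_sorted321 n (j - 1) \<inter>
      (\<Union>i\<in>{j..n}. insert_max n i ` tail_sorted321 n i) = {}" by blast
  have "card (\<Union>i\<in>{j..n}. insert_max n i ` tail_sorted321 n i) =
      (\<Sum>i=j..n. card (insert_max n i ` tail_sorted321 n i))"
    by (rule card_UN_disjoint) (use fin dis in simp_all)
  also have "\<dots> = (\<Sum>i=j..n. card (tail_sorted321 n i))"
    by (intro sum.cong) (use ci in simp_all)
  finally have "card (\<Union>i\<in>{j..n}. insert_max n i ` tail_sorted321 n i) =
      (\<Sum>i=j..n. card (tail_sorted321 n i))" .
  then show ?thesis unfolding tail_sorted321_Suc[OF assms]
    using card_Un_disjoint[OF _ _ d0] fin ci by simp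
qed

text \<open>\<open>t n j\<close> is the ballot number in reflection form: paths with
  \<open>n\<close> up-steps and \<open>n - j\<close> down-steps that stay nonnegative. Pascal's rule
  gives \<open>t (Suc n) j = t (Suc n) (Suc j) + t n (j - 1)\<close>, and descending from
  \<open>j = Suc n\<close> accumulates the sum.\<close>

lemma ballot_sum:
  fixes t :: "nat \<Rightarrow> nat \<Rightarrow> real"
  defines "t \<equiv> \<lambda>n j. real ((2 * n - j) choose n) - real ((2 * n - j) choose (Suc n))"
  assumes "1 \<le> j" "j \<le> Suc n"
  shows "t (Suc n) j = t n (j - 1) + (\<Sum>i=j..n. t n i)"
  using assms(3,2)
proof (induction j rule: inc_induct)
  case base
  show ?case by (simp add: t_def)
next
  case (step j)
  have "2 * Suc n - j = Suc (2 * n - (j - 1))" "2 * Suc n - Suc j = 2 * n - (j - 1)"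
    using step by auto
  then have "t (Suc n) j = t (Suc n) (Suc j) + t n (j - 1)"
    by (simp add: t_def)
  moreover have "(\<Sum>i=j..n. t n i) = t n j + (\<Sum>i=Suc j..n. t n i)"
    using step by (subst sum.atLeast_Suc_atMost) auto
  ultimately show ?case using step by simp
qed

lemma card_tail_sorted321:
  "j \<le> n \<Longrightarrow> real (card (tail_sorted321 n j)) =
     real ((2 * n - j) choose n) - real ((2 * n - j) choose (Suc n))"
proof (induction n arbitrary: j)
  case 0
  have "tail_sorted321 0 0 = {[]}" by (auto simp: tail_sorted321_def)
  then show ?case using 0 by simp
next
  case (Suc n)
  have pos: "real (card (tail_sorted321 (Suc n) j)) =
     real ((2 * Suc n - j) choose Suc n) - real ((2 * Suc n - j) choose (Suc (Suc n)))"
    if "1 \<le> j" "j \<le> Suc n" for j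
  proof -
    have "(\<Sum>i=j..n. real (card (tail_sorted321 n i))) =
       (\<Sum>i=j..n. real ((2 * n - i) choose n) - real ((2 * n - i) choose (Suc n)))"
      by (intro sum.cong) (use Suc.IH in auto)
    moreover have "real (card (tail_sorted321 n (j - 1))) =
       real ((2 * n - (j - 1)) choose n) - real ((2 * n - (j - 1)) choose (Suc n))"
      using Suc.IH that by auto
    ultimately show ?thesis
      unfolding card_tail_sorted321_Suc[OF that] ballot_sum[OF that] by simp
  qed
  show ?case
  proof (cases "j = 0")
    \<comment> \<open>The recursion needs \<open>j \<ge> 1\<close>. A single last entry is always
      sorted, so \<open>j = 0\<close> has the same set as \<open>j = 1\<close>, and the two formulas
      agree by symmetry of the binomials.\<close>
    case True
    have "sorted (drop n xs)" if "xs \<in> perms321 (Suc n)" for xs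
    proof -
      have "length (drop n xs) = 1" using perms321_length[OF that] by simp
      then obtain a where "drop n xs = [a]" by (metis One_nat_def length_0_conv length_Suc_conv)
      then show ?thesis by simp
    qed
    then have "tail_sorted321 (Suc n) 0 = tail_sorted321 (Suc n) 1"
      by (auto simp: tail_sorted321_def perms321_length)
    moreover have "Suc (2 * n) choose n = Suc (2 * n) choose Suc n"
      by (subst binomial_symmetric) auto
    ultimately show ?thesis using True pos[of 1] by simp
  qed (use pos Suc.prems in auto)
qed

lemma card_perms321: "real (card (perms321 n)) = catalan n"
proof -
  have "perms321 n = tail_sorted321 n 0" by (auto simp: tail_sorted321_def perms321_length)
  then have "real (card (perms321 n)) = real ((2 * n) choose n) - real ((2 * n) choose (Suc n))"
    using card_tail_sorted321[of 0 n] by simp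
  moreover have "Suc n * ((2 * n) choose (Suc n)) = n * ((2 * n) choose n)"
    using binomial_absorb_comp[of "2*n" n] binomial_absorption[of n "2 * n"]
    by (cases n) (auto simp: mult.commute Suc_times_binomial_eq)
  then have "real (Suc n) * real ((2 * n) choose (Suc n)) = real n * real ((2 * n) choose n)"
    by (metis of_nat_mult)
  ultimately have "real (Suc n) * real (card (perms321 n)) = real ((2 * n) choose n)"
    by (simp only: right_diff_distrib) (simp add: algebra_simps)
  then show ?thesis by (simp add: catalan_def field_simps)
qed

section \<open>Fixed points as cut points\<close>

definition fixpts :: "nat list \<Rightarrow> nat set" where
  "fixpts xs = {i. 1 \<le> i \<and> i \<le> length xs \<and> xs ! (i - 1) = i}"

text \<open>The fixed-point set of \<open>\<alpha> \<oplus> 1 \<oplus> \<beta>\<close> when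
  \<open>\<alpha>\<close> has size \<open>m - 1\<close> and no fixed point and
  \<open>\<beta>\<close> has fixed-point set \<open>A\<close>.\<close>

definition prepend_fix :: "nat \<Rightarrow> nat set \<Rightarrow> nat set" where
  "prepend_fix m A = insert m ((+) m ` A)"

text \<open>For \<open>ys\<close> of length \<open>k\<close> this is the direct sum
  \<open>ys \<oplus> 1 \<oplus> zs\<close>.\<close>

definition join_at :: "nat \<Rightarrow> nat list \<Rightarrow> nat list \<Rightarrow> nat list" where
  "join_at k ys zs = ys @ Suc k # map ((+) (Suc k)) zs"

lemma fixpts_subset: "fixpts xs \<subseteq> {1..length xs}"
  by (auto simp: fixpts_def)

lemma finite_fixpts [simp]: "finite (fixpts xs)"
  by (rule finite_subset[OF fixpts_subset]) simp

lemma fixpts_join_at: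
  assumes "length ys = k"
  shows "fixpts (join_at k ys zs) = fixpts ys \<union> prepend_fix (Suc k) (fixpts zs)"
proof (rule set_eqI)
  fix i
  consider "i \<le> k" | "i = Suc k" | j where "i = Suc k + j" "1 \<le> j"
    by (metis add_leE le_add1 le_Suc_ex linorder_not_le not_less_eq_eq not_less_less_Suc_eq
        Suc_leI add_Suc_right plus_1_eq_Suc add.commute)
  then show "i \<in> fixpts (join_at k ys zs) \<longleftrightarrow> i \<in> fixpts ys \<union> prepend_fix (Suc k) (fixpts zs)"
  proof cases
    case 1
    then have "i \<in> fixpts (join_at k ys zs) \<longleftrightarrow> i \<in> fixpts ys"
      using assms by (auto simp: fixpts_def join_at_def nth_append)
    then show ?thesis using 1 by (auto simp: prepend_fix_def)
  next
    case 2
    then show ?thesis using assms by (auto simp: fixpts_def join_at_def prepend_fix_def)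
  next
    case 3
    then obtain l where l: "j = Suc l" by (cases j) auto
    have "i \<notin> fixpts ys" using 3 assms by (auto simp: fixpts_def)
    moreover have "i \<in> prepend_fix (Suc k) (fixpts zs) \<longleftrightarrow> j \<in> fixpts zs"
      using 3 by (auto simp: prepend_fix_def)
    moreover have "i \<in> fixpts (join_at k ys zs) \<longleftrightarrow> j \<in> fixpts zs"
      using 3 l assms by (auto simp: fixpts_def join_at_def nth_append)
    ultimately show ?thesis by blast
  qed
qed

lemma join_at_inject:
  assumes "length ys = k" "length ys' = k" "join_at k ys zs = join_at k ys' zs'"
  shows "ys = ys' \<and> zs = zs'"
  using assms by (auto simp: join_at_def intro: map_injective[of "(+) (Suc k)"])

lemma join_at_mem_perms321:
  assumes "ys \<in> perms321 k" "zs \<in> perms321 n"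
  shows "join_at k ys zs \<in> perms321 (Suc k + n)"
proof -
  have ys: "distinct ys" "set ys = {1..k}" "no321 ys" and zs: "distinct zs" "set zs = {1..n}" "no321 zs"
    using assms by (auto simp: perms321_def)
  have "no321 (Suc k # map ((+) (Suc k)) zs)"
    using zs by (auto simp: no321_map_add[of "Suc k", simplified] filter_empty_conv)
  then have "no321 (join_at k ys zs)" unfolding join_at_def
    using ys zs by (subst no321_append_less) auto
  moreover have "distinct (join_at k ys zs)"
    using ys zs by (auto simp: join_at_def distinct_map inj_on_def)
  moreover have "set (join_at k ys zs) = {1..Suc k + n}"
  proof -
    have "set (join_at k ys zs) = {1..k} \<union> insert (Suc k) ((+) (Suc k) ` {1..n})"
      using ys zs by (simp add: join_at_def)
    also have "(+) (Suc k) ` {1..n} = {Suc k + 1..Suc k + n}"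
      by (simp only: image_add_atLeastAtMost add.commute)
    also have "{1..k} \<union> insert (Suc k) {Suc k + 1..Suc k + n} = {1..Suc k + n}" by auto
    finally show ?thesis .
  qed
  ultimately show ?thesis by (simp add: perms321_def)
qed

text \<open>An entry above \<open>m\<close> to the left of a fixed point \<open>m\<close> forces, by counting, an entry below \<open>m\<close>
  to its right, and the three of them form the pattern 321. So fixed points are direct-sum cut points.\<close>
lemma perms321_splitE:
  assumes "xs \<in> perms321 n" "Suc k \<in> fixpts xs"
  obtains ys zs where "xs = join_at k ys zs" "ys \<in> perms321 k" "zs \<in> perms321 (n - Suc k)"
proof -
  define ys ws where "ys = take k xs" and "ws = drop (Suc k) xs"
  have len: "length xs = n" and kn: "k < n" and nth: "xs ! k = Suc k"
    using assms perms321_length[OF assms(1)] by (auto simp: fixpts_def)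
  have e: "xs = ys @ Suc k # ws" using id_take_nth_drop[of k xs] len kn nth
    by (simp add: ys_def ws_def)
  have d: "distinct xs" and st: "set xs = {1..n}" and av: "no321 xs"
    using assms by (auto simp: perms321_def)
  have ly: "card (set ys) = k" and lw: "card (set ws) = n - Suc k"
    using d len kn by (auto simp: ys_def ws_def distinct_card)
  have disj: "set ys \<inter> set ws = {}" "Suc k \<notin> set ys" "Suc k \<notin> set ws" using d by (auto simp: e)
  have un: "set ys \<union> insert (Suc k) (set ws) = {1..n}" using st by (simp add: e)
  have yk: "set ys = {1..k}"
  proof (cases "\<exists>y\<in>set ys. Suc k < y")
    case False
    then have "set ys \<subseteq> {1..k}" using un disj by (fastforce simp: not_less le_Suc_eq)
    then show ?thesis using ly by (intro card_subset_eq) auto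
  next
    case True
    \<comment> \<open>All \<open>n - Suc k\<close> entries on the right exceed the fixed point, so
      they exhaust the large values and none is left for \<open>ys\<close>. This contradicts the
      case, but already yields the goal.\<close>
    then have "\<forall>w\<in>set ws. Suc k \<le> w" using no321_straddle[of ys "Suc k" ws] av e by blast
    then have "set ws \<subseteq> {Suc (Suc k)..n}" using un disj by (fastforce simp: Suc_le_eq le_less)
    then have "set ws = {Suc (Suc k)..n}" using lw by (intro card_subset_eq) auto
    then have "set ys \<subseteq> {1..k}" using un disj by (fastforce simp: not_less_eq_eq)
    then show ?thesis using ly by (intro card_subset_eq) auto
  qed
  have wk: "set ws = {Suc (Suc k)..n}"
  proof -
    have "set ws = {1..n} - insert (Suc k) (set ys)" using un disj by blast
    moreover have "{1..n} - insert (Suc k) {1..k} = {Suc (Suc k)..n}" by auto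
    ultimately show ?thesis by (simp only: yk)
  qed
  define zs where "zs = map (\<lambda>w. w - Suc k) ws"
  have wz: "ws = map ((+) (Suc k)) zs"
  proof -
    have "map ((+) (Suc k) \<circ> (\<lambda>w. w - Suc k)) ws = ws" by (rule map_idI) (simp add: wk)
    then show ?thesis by (simp add: zs_def)
  qed
  have "no321 ys \<and> no321 (Suc k # ws)"
    using av unfolding e by (subst (asm) no321_append_less) (auto simp: yk wk)
  then have av': "no321 ys" "no321 zs" unfolding wz by (auto simp only: no321_map_add no321.simps)
  have "distinct ws" using d by (simp add: e)
  then have "distinct zs" unfolding wz by (simp only: distinct_map)
  moreover have "set zs = {1..n - Suc k}"
  proof -
    have "1 + Suc k = Suc (Suc k)" "n - Suc k + Suc k = n" using kn by auto
    then have "(+) (Suc k) ` set zs = (+) (Suc k) ` {1..n - Suc k}"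
      using wk unfolding wz set_map by (simp only: image_add_atLeastAtMost add.commute)
    then show ?thesis by (simp only: inj_image_eq_iff[OF inj_on_add])
  qed
  ultimately have "zs \<in> perms321 (n - Suc k)" using av' by (simp add: perms321_def)
  moreover have "ys \<in> perms321 k" using av' yk d unfolding e by (simp add: perms321_def)
  moreover have "xs = join_at k ys zs" unfolding join_at_def e wz ..
  ultimately show ?thesis using that by blast
qed

definition fixcount :: "nat \<Rightarrow> nat set \<Rightarrow> nat" where
  "fixcount n A = card {xs \<in> perms321 n. fixpts xs = A}"

lemma card_join_at:
  assumes "U \<subseteq> perms321 k" "V \<subseteq> perms321 n"
  shows "card ((\<lambda>(ys, zs). join_at k ys zs) ` (U \<times> V)) = card U * card V"
proof -
  have "inj_on (\<lambda>(ys, zs). join_at k ys zs) (U \<times> V)"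
  proof (rule inj_onI, clarify)
    fix ys zs ys' zs'
    assume "ys \<in> U" "ys' \<in> U" and j: "join_at k ys zs = join_at k ys' zs'"
    then have "length ys = k" "length ys' = k" using assms perms321_length by blast+
    from join_at_inject[OF this j] show "ys = ys' \<and> zs = zs'" .
  qed
  then show ?thesis by (simp add: card_image card_cartesian_product)
qed

text \<open>\<open>A\<close> lies below the cut point \<open>Suc k\<close>, and the absence of
  \<open>0\<close> keeps the shifted copies strictly above it; the pieces can be read off
  separately.\<close>

lemma join_prepend_eq_iff:
  assumes "A \<subseteq> {1..k}" "0 \<notin> B" "0 \<notin> C"
  shows "A \<union> prepend_fix (Suc k) B = prepend_fix (Suc k) C \<longleftrightarrow> A = {} \<and> B = C"
proof
  assume eq: "A \<union> prepend_fix (Suc k) B = prepend_fix (Suc k) C"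
  have "A \<inter> prepend_fix (Suc k) C = {}" using assms by (auto simp: prepend_fix_def)
  then have "A = {}" using eq by blast
  moreover have "(+) (Suc k) ` B = (+) (Suc k) ` C"
  proof -
    have "Suc k \<notin> (+) (Suc k) ` B" "Suc k \<notin> (+) (Suc k) ` C" using assms by auto
    from insert_ident[OF this] show ?thesis
      using eq unfolding \<open>A = {}\<close> prepend_fix_def Un_empty_left by blast
  qed
  then have "B = C" by (simp only: inj_image_eq_iff[OF inj_on_add])
  ultimately show "A = {} \<and> B = C" by blast
qed simp

text \<open>Cutting at the smallest prescribed fixed point is a bijection onto pairs: a derangement
  of size \<open>k\<close> and a permutation of size \<open>n\<close> that inherits the remaining
  fixed points.\<close>

lemma fixcount_prepend:
  assumes "0 \<notin> B"
  shows "fixcount (n + Suc k) (prepend_fix (Suc k) B) = fixcount k {} * fixcount n B"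
proof -
  let ?U = "{xs \<in> perms321 k. fixpts xs = {}}" and ?V = "{xs \<in> perms321 n. fixpts xs = B}"
  have fp: "fixpts (join_at k ys zs) = prepend_fix (Suc k) B \<longleftrightarrow> fixpts ys = {} \<and> fixpts zs = B"
    if "ys \<in> perms321 k" for ys zs
  proof -
    have l: "length ys = k" using that by (rule perms321_length)
    then show ?thesis unfolding fixpts_join_at[OF l]
      using fixpts_subset[of ys] fixpts_subset[of zs] assms by (intro join_prepend_eq_iff) auto
  qed
  have "{xs \<in> perms321 (n + Suc k). fixpts xs = prepend_fix (Suc k) B} =
      (\<lambda>(ys, zs). join_at k ys zs) ` (?U \<times> ?V)" (is "?L = ?R")
  proof (intro equalityI subsetI)
    fix xs assume xs: "xs \<in> ?L"
    then have "xs \<in> perms321 (n + Suc k)" "Suc k \<in> fixpts xs" by (auto simp: prepend_fix_def)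
    then obtain ys zs where *: "xs = join_at k ys zs" "ys \<in> perms321 k" "zs \<in> perms321 (n + Suc k - Suc k)"
      by (rule perms321_splitE)
    then have "fixpts ys = {}" "fixpts zs = B" using xs fp by auto
    then show "xs \<in> ?R" using * by auto
  next
    fix xs assume "xs \<in> ?R"
    then obtain ys zs where "xs = join_at k ys zs" "ys \<in> ?U" "zs \<in> ?V" by auto
    then show "xs \<in> ?L" using fp[of ys zs] join_at_mem_perms321[of ys k zs n] by (simp add: add.commute)
  qed
  then show ?thesis unfolding fixcount_def by (simp only:) (rule card_join_at; auto)
qed

text \<open>Permutations are sorted by their smallest fixed point \<open>Suc k\<close>, which makes
  the pieces disjoint. The identity supplies the assumption \<open>first\<close> with
  \<open>d n = fixcount n {}\<close>.\<close>

lemma catalan_first_fixpt: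
  "catalan n = real (fixcount n {}) + (\<Sum>k<n. real (fixcount k {}) * catalan (n - 1 - k))"
proof -
  let ?D = "\<lambda>k. {xs \<in> perms321 k. fixpts xs = {}}"
  let ?J = "\<lambda>k. (\<lambda>(ys, zs). join_at k ys zs) ` (?D k \<times> perms321 (n - Suc k))"
  have first: "fixpts xs \<inter> {1..k} = {} \<and> Suc k \<in> fixpts xs" if J: "xs \<in> ?J k" for xs k
  proof -
    obtain ys zs where *: "xs = join_at k ys zs" "ys \<in> ?D k" using J by auto
    then have "length ys = k" using perms321_length by blast
    from fixpts_join_at[OF this] * show ?thesis by (auto simp: prepend_fix_def)
  qed
  have dis: "?J k \<inter> ?J l = {}" if "k \<noteq> l" for k l
  proof -
    have "\<not> (xs \<in> ?J k \<and> xs \<in> ?J l)" if "k < l" for xs k l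
    proof
      assume "xs \<in> ?J k \<and> xs \<in> ?J l"
      then have "Suc k \<in> fixpts xs" "fixpts xs \<inter> {1..l} = {}" using first by blast+
      then show False using that by auto
    qed
    then show ?thesis using \<open>k \<noteq> l\<close> by (meson disjoint_iff linorder_neqE_nat)
  qed
  have "perms321 n = ?D n \<union> (\<Union>k<n. ?J k)"
  proof (intro equalityI subsetI)
    fix xs assume xs: "xs \<in> perms321 n"
    show "xs \<in> ?D n \<union> (\<Union>k<n. ?J k)"
    proof (cases "fixpts xs = {}")
      case False
      define m where "m = Min (fixpts xs)"
      have m: "m \<in> fixpts xs" using False by (simp add: m_def)
      then have "1 \<le> m" "m \<le> n" using fixpts_subset[of xs] perms321_length[OF xs] by auto
      then obtain k where k: "m = Suc k" "k < n" by (cases m) auto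
      obtain ys zs where *: "xs = join_at k ys zs" "ys \<in> perms321 k" "zs \<in> perms321 (n - Suc k)"
        using perms321_splitE[OF xs] m k by metis
      have "fixpts ys = {}"
      proof (rule ccontr)
        assume "fixpts ys \<noteq> {}"
        then obtain i where i: "i \<in> fixpts ys" by blast
        then have "i \<in> fixpts xs" using * fixpts_join_at[OF perms321_length[OF *(2)]] by auto
        then have "m \<le> i" by (simp add: m_def)
        then show False using i fixpts_subset[of ys] perms321_length[OF *(2)] k by auto
      qed
      then have "xs \<in> ?J k" using * by auto
      then show ?thesis using k by blast
    qed (use xs in blast)
  next
    fix xs assume "xs \<in> ?D n \<union> (\<Union>k<n. ?J k)"
    then consider "xs \<in> perms321 n" | k ys zs where "k < n" "ys \<in> perms321 k"
      "zs \<in> perms321 (n - Suc k)" "xs = join_at k ys zs" by auto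
    then show "xs \<in> perms321 n"
    proof cases
      case 2
      then show ?thesis using join_at_mem_perms321[of ys k zs "n - Suc k"] by simp
    qed
  qed
  moreover have "?D n \<inter> (\<Union>k<n. ?J k) = {}" using first by blast
  moreover have "finite (?J k)" for k by simp
  ultimately have "card (perms321 n) = card (?D n) + card (\<Union>k<n. ?J k)"
    by (metis (no_types, lifting) card_Un_disjoint finite_Un finite_perms321)
  also have "card (\<Union>k<n. ?J k) = (\<Sum>k<n. card (?J k))"
    by (rule card_UN_disjoint) (use dis in simp_all)
  also have "\<dots> = (\<Sum>k<n. fixcount k {} * card (perms321 (n - Suc k)))"
    unfolding fixcount_def by (intro sum.cong refl card_join_at) auto
  finally have "real (card (perms321 n)) =
      real (fixcount n {}) + (\<Sum>k<n. real (fixcount k {}) * real (card (perms321 (n - Suc k))))"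
    by (simp add: fixcount_def)
  then show ?thesis by (simp add: card_perms321)
qed

section \<open>Reverse-complement symmetry between the two ends\<close>

definition reflect :: "nat \<Rightarrow> nat set \<Rightarrow> nat set" where
  "reflect n A = (\<lambda>i. n + 1 - i) ` A"

text \<open>Half-turn of the permutation diagram: it preserves 321 and sends a fixed point
  \<open>i\<close> to \<open>n + 1 - i\<close>.\<close>

definition rev_comp :: "nat \<Rightarrow> nat list \<Rightarrow> nat list" where
  "rev_comp n xs = rev (map (\<lambda>x. n + 1 - x) xs)"

lemma reflect_reflect: "A \<subseteq> {1..n} \<Longrightarrow> reflect n (reflect n A) = A"
proof -
  assume "A \<subseteq> {1..n}"
  then have "reflect n (reflect n A) = (\<lambda>x. x) ` A"
    unfolding reflect_def image_image by (intro image_cong) auto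
  then show ?thesis by simp
qed

lemma rev_comp_mem:
  assumes "xs \<in> perms321 n"
  shows "rev_comp n xs \<in> perms321 n"
proof -
  have d: "distinct xs" and st: "set xs = {1..n}" and av: "no321 xs" and len: "length xs = n"
    using assms perms321_length[OF assms] by (auto simp: perms321_def)
  have "x \<in> (\<lambda>x. n + 1 - x) ` {1..n}" if "x \<in> {1..n}" for x
    by (rule image_eqI[of _ _ "n + 1 - x"]) (use that in auto)
  then have "(\<lambda>x. n + 1 - x) ` {1..n} = {1..n}" by auto
  then have "set (rev_comp n xs) = {1..n}" using st by (simp add: rev_comp_def)
  moreover have "distinct (rev_comp n xs)"
    using d st by (auto simp: rev_comp_def distinct_map inj_on_def)
  moreover have "no321 (rev_comp n xs)"
    unfolding no321_iff_nth
  proof (intro allI impI notI)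
    fix i j k
    assume ijk: "i < j \<and> j < k \<and> k < length (rev_comp n xs)"
      and pat: "rev_comp n xs ! i > rev_comp n xs ! j \<and> rev_comp n xs ! j > rev_comp n xs ! k"
    have l: "length (rev_comp n xs) = n" using len by (simp add: rev_comp_def)
    have nth: "rev_comp n xs ! i = n + 1 - xs ! (n - Suc i)" if "i < n" for i
      using that len by (simp add: rev_comp_def rev_nth)
    have "xs ! (n - Suc k) > xs ! (n - Suc j)" "xs ! (n - Suc j) > xs ! (n - Suc i)"
    proof -
      have lt: "y < x" if "a - x < a - y" for a x y :: nat using that by arith
      have "i < n" "j < n" "k < n" using ijk l by auto
      then show "xs ! (n - Suc k) > xs ! (n - Suc j)" "xs ! (n - Suc j) > xs ! (n - Suc i)"
        using pat nth lt by metis+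
    qed
    moreover have "n - Suc k < n - Suc j \<and> n - Suc j < n - Suc i \<and> n - Suc i < length xs"
      using ijk l len by auto
    ultimately show False using av unfolding no321_iff_nth by blast
  qed
  ultimately show ?thesis by (simp add: perms321_def)
qed

lemma rev_comp_rev_comp:
  assumes "xs \<in> perms321 n"
  shows "rev_comp n (rev_comp n xs) = xs"
proof -
  have "map ((\<lambda>x. n + 1 - x) \<circ> (\<lambda>x. n + 1 - x)) xs = xs"
    using assms by (intro map_idI) (auto simp: perms321_def)
  then show ?thesis by (simp add: rev_comp_def rev_map)
qed

text \<open>One inclusion for every permutation suffices; applied to \<open>rev_comp n xs\<close> it
  gives the other, both maps being involutions.\<close>

lemma fixpts_rev_comp:
  assumes "xs \<in> perms321 n"
  shows "fixpts (rev_comp n xs) = reflect n (fixpts xs)"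
proof -
  have sub: "reflect n (fixpts xs) \<subseteq> fixpts (rev_comp n xs)" if xs: "xs \<in> perms321 n" for xs
  proof
    fix i assume "i \<in> reflect n (fixpts xs)"
    then obtain j where j: "j \<in> fixpts xs" "i = n + 1 - j" by (auto simp: reflect_def)
    have len: "length xs = n" using xs by (rule perms321_length)
    have jn: "1 \<le> j" "j \<le> n" "xs ! (j - 1) = j" using j len by (auto simp: fixpts_def)
    have "rev_comp n xs ! (i - 1) = n + 1 - xs ! (n - Suc (i - 1))"
      using jn len j by (simp add: rev_comp_def rev_nth)
    also have "n - Suc (i - 1) = j - 1" using jn j by auto
    finally show "i \<in> fixpts (rev_comp n xs)"
      using jn j len by (auto simp: fixpts_def rev_comp_def)
  qed
  have "fixpts (rev_comp n xs) \<subseteq> {1..n}"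
    using fixpts_subset[of "rev_comp n xs"] perms321_length[OF rev_comp_mem[OF assms]] by simp
  then have "fixpts (rev_comp n xs) = reflect n (reflect n (fixpts (rev_comp n xs)))"
    by (simp only: reflect_reflect)
  also have "\<dots> \<subseteq> reflect n (fixpts xs)"
    using sub[OF rev_comp_mem[OF assms]] rev_comp_rev_comp[OF assms]
    by (auto simp: reflect_def)
  finally show ?thesis using sub[OF assms] by blast
qed

lemma fixcount_reflect:
  assumes "A \<subseteq> {1..n}"
  shows "fixcount n (reflect n A) = fixcount n A"
proof -
  have "bij_betw (rev_comp n) {xs \<in> perms321 n. fixpts xs = A} {xs \<in> perms321 n. fixpts xs = reflect n A}"
  proof (rule bij_betw_byWitness[where f' = "rev_comp n"])
    show "rev_comp n ` {xs \<in> perms321 n. fixpts xs = reflect n A} \<subseteq> {xs \<in> perms321 n. fixpts xs = A}"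
      using reflect_reflect[OF assms] by (auto simp: fixpts_rev_comp rev_comp_mem)
  qed (auto simp: rev_comp_rev_comp fixpts_rev_comp rev_comp_mem)
  then show ?thesis unfolding fixcount_def by (simp add: bij_betw_same_card)
qed

section \<open>Asymptotics with fixed points prescribed at both ends\<close>

text \<open>Removing the minimum and shifting the rest down undoes \<open>prepend_fix\<close>. The
  induction thus follows the gaps between successive fixed points.\<close>

lemma prepend_fix_induct [consumes 2, case_names empty prepend]:
  assumes "finite A" "0 \<notin> A" "P {}"
    and step: "\<And>k A. finite A \<Longrightarrow> 0 \<notin> A \<Longrightarrow> P A \<Longrightarrow> P (prepend_fix (Suc k) A)"
  shows "P A"
  using assms(1,2)
proof (induction "card A" arbitrary: A rule: less_induct)
  case less
  show ?case
  proof (cases "A = {}")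
    case False
    define m where "m = Min A"
    have m: "m \<in> A" "\<And>x. x \<in> A \<Longrightarrow> m \<le> x" using less False by (auto simp: m_def)
    define B where "B = (\<lambda>x. x - m) ` (A - {m})"
    obtain k where k: "m = Suc k" using m less by (cases m) auto
    have "0 \<notin> B" using m by (force simp: B_def)
    moreover have "card B \<le> card (A - {m})" unfolding B_def by (rule card_image_le) (use less in simp)
    then have "card B < card A" using m less by (meson card_Diff1_less le_less_trans)
    moreover have "finite B" using less by (simp add: B_def)
    ultimately have "P (prepend_fix m B)" unfolding k using step less by blast
    moreover have "(+) m ` B = A - {m}"
    proof -
      have "(+) m ` B = (\<lambda>x. x) ` (A - {m})" unfolding B_def image_image
        by (intro image_cong) (use m in auto)
      then show ?thesis by simp
    qed
    then have "prepend_fix m B = A" using m by (auto simp: prepend_fix_def)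
    ultimately show ?thesis by simp
  qed (use assms in simp)
qed

text \<open>Enlarging the size by \<open>Suc k\<close> shifts \<open>reflect n B\<close> by
  \<open>Suc k\<close>, so \<open>B\<close> keeps its distances from the right end and
  \<open>fixcount_prepend\<close> factors exactly; the shifted Catalan ratio adds the power of
  \<open>1/4\<close>.\<close>

lemma fixcount_two_sided_step:
  assumes "finite B" "0 \<notin> A" "0 \<notin> B"
    and lim: "(\<lambda>n. real (fixcount n (A \<union> reflect n B)) / catalan n) \<longlonglongrightarrow> L"
  shows "(\<lambda>n. real (fixcount n (prepend_fix (Suc k) A \<union> reflect n B)) / catalan n)
    \<longlonglongrightarrow> real (fixcount k {}) * (1/4) ^ Suc k * L"
proof (rule LIMSEQ_offset[where k = "Suc k"])
  let ?f = "\<lambda>n. real (fixcount n (A \<union> reflect n B)) / catalan n"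
  have ev: "\<forall>\<^sub>F n in sequentially. real (fixcount k {}) * (catalan n / catalan (n + Suc k)) * ?f n =
     real (fixcount (n + Suc k) (prepend_fix (Suc k) A \<union> reflect (n + Suc k) B)) / catalan (n + Suc k)"
  proof (rule eventually_sequentiallyI)
    \<comment> \<open>Beyond the elements of \<open>B\<close> the truncated subtraction in
      \<open>reflect\<close> is harmless and never yields \<open>0\<close>; \<open>insert 0\<close>
      gives \<open>Max\<close> a value for empty \<open>B\<close>.\<close>
    fix n assume "Max (insert 0 B) \<le> n"
    then have B: "\<And>b. b \<in> B \<Longrightarrow> b \<le> n" using assms(1) by simp
    have "reflect (n + Suc k) B = (+) (Suc k) ` reflect n B"
      unfolding reflect_def image_image by (intro image_cong) (auto dest: B)
    then have "prepend_fix (Suc k) A \<union> reflect (n + Suc k) B = prepend_fix (Suc k) (A \<union> reflect n B)"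
      by (auto simp: prepend_fix_def)
    moreover have "0 \<notin> A \<union> reflect n B" using assms B by (force simp: reflect_def)
    ultimately have "fixcount (n + Suc k) (prepend_fix (Suc k) A \<union> reflect (n + Suc k) B) =
        fixcount k {} * fixcount n (A \<union> reflect n B)"
      using fixcount_prepend[of "A \<union> reflect n B" n k] by (simp only: not_False_eq_True simp_thms)
    then show "real (fixcount k {}) * (catalan n / catalan (n + Suc k)) * ?f n =
     real (fixcount (n + Suc k) (prepend_fix (Suc k) A \<union> reflect (n + Suc k) B)) / catalan (n + Suc k)"
      using catalan_pos[of n] by simp
  qed
  have "(\<lambda>n. real (fixcount k {}) * (catalan n / catalan (n + Suc k)) * ?f n)
      \<longlonglongrightarrow> real (fixcount k {}) * (1/4) ^ Suc k * L"
    by (intro tendsto_mult tendsto_const lim catalan_shift_ratio_tendsto)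
  then show "(\<lambda>n. real (fixcount (n + Suc k) (prepend_fix (Suc k) A \<union> reflect (n + Suc k) B)) /
      catalan (n + Suc k)) \<longlonglongrightarrow> real (fixcount k {}) * (1/4) ^ Suc k * L"
    by (rule Lim_transform_eventually[OF _ ev])
qed

text \<open>\<open>p\<close> is abstract: \<open>p0\<close> and \<open>pS\<close> determine it on
  finite sets of positive integers, and the renewal law is later shown to satisfy them. The
  one-sided limit \<open>one\<close>, reflected, is the base of the induction on
  \<open>A\<close>.\<close>

lemma fixcount_two_sided_tendsto:
  fixes p :: "nat set \<Rightarrow> real"
  assumes p0: "p {} = 2/3"
    and pS: "\<And>k A. finite A \<Longrightarrow> 0 \<notin> A \<Longrightarrow>
        p (prepend_fix (Suc k) A) = real (fixcount k {}) * (1/4) ^ Suc k * p A"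
    and A: "finite A" "0 \<notin> A" and B: "finite B" "0 \<notin> B"
  shows "(\<lambda>n. real (fixcount n (A \<union> reflect n B)) / catalan n) \<longlonglongrightarrow> p A * p B"
proof -
  have one: "(\<lambda>n. real (fixcount n C) / catalan n) \<longlonglongrightarrow> p C * p {}" if "finite C" "0 \<notin> C" for C
    using that
  proof (induction C rule: prepend_fix_induct)
    case empty
    show ?case using fine_ratio_tendsto[OF catalan_first_fixpt] by (simp add: p0)
  next
    case (prepend k C)
    then show ?case using fixcount_two_sided_step[of "{}" C "p C * p {}" k]
      by (simp add: reflect_def pS mult.assoc)
  qed
  from A show ?thesis
  proof (induction A rule: prepend_fix_induct)
    case empty
    have "\<forall>\<^sub>F n in sequentially. real (fixcount n B) / catalan n =
        real (fixcount n ({} \<union> reflect n B)) / catalan n"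
    proof (rule eventually_sequentiallyI)
      fix n assume "Max (insert 0 B) \<le> n"
      then have "B \<subseteq> {1..n}" using B by (auto simp: Suc_le_eq) (metis gr0I)
      from fixcount_reflect[OF this] show "real (fixcount n B) / catalan n =
        real (fixcount n ({} \<union> reflect n B)) / catalan n" by simp
    qed
    from Lim_transform_eventually[OF one[OF B] this] show ?case by (simp only: mult.commute)
  next
    case (prepend k A)
    then show ?case using fixcount_two_sided_step[of B A "p A * p B" k] B
      by (simp add: pS mult.assoc)
  qed
qed

section \<open>The limit law\<close>

definition catalan_pmf :: "nat pmf" where
  "catalan_pmf = embed_pmf catalan_law"

lemma catalan_law_nonneg: "0 \<le> catalan_law k"
  by (simp add: catalan_law_def)

lemma pmf_catalan_pmf: "pmf catalan_pmf k = catalan_law k"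
  unfolding catalan_pmf_def
proof (rule pmf_embed_pmf)
  show "(\<integral>\<^sup>+ x. ennreal (catalan_law x) \<partial>count_space UNIV) = 1"
    using suminf_ennreal_eq[OF catalan_law_nonneg catalan_law_sums]
    by (simp add: nn_integral_count_space_nat)
qed (rule catalan_law_nonneg)

text \<open>The division by \<open>real 0\<close> in \<open>catalan_law 0\<close> gives \<open>0\<close>, so the law lives on \<open>{1..}\<close>.\<close>
lemma catalan_law_0 [simp]: "catalan_law 0 = 0"
  by (simp add: catalan_law_def)

lemma catalan_law_1: "catalan_law 1 = 1/2"
  by (simp add: catalan_law_def)

text \<open>The extra \<open>1/2\<close> is the probability that the geometric clock lets the
  process take one more step.\<close>

lemma catalan_law_Suc: "catalan_law (Suc k) / 2 = catalan k * (1/4) ^ Suc k"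
proof -
  have "(2 :: real) ^ (2 * Suc k - 1) = 2 * 4 ^ k" by (simp add: power_mult)
  then show ?thesis by (simp add: catalan_law_def catalan_def power_divide)
qed

lemma set_catalan_pmf: "x \<in> set_pmf catalan_pmf \<Longrightarrow> 1 \<le> x"
  by (cases x) (auto simp: set_pmf_iff pmf_catalan_pmf)

text \<open>The law of the list of the first \<open>N\<close> steps: it carries clock and steps
  together on a countable space.\<close>

definition renewal_pmf :: "nat list pmf" where
  "renewal_pmf = bind_pmf (geometric_pmf (1/2)) (\<lambda>n. replicate_pmf n catalan_pmf)"

text \<open>Memorylessness of the geometric law: stop with probability \<open>1/2\<close>, otherwise
  take one step and start afresh.\<close>

lemma renewal_pmf_unfold:
  "renewal_pmf = bind_pmf (bernoulli_pmf (1/2)) (\<lambda>b. if b then return_pmf []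
     else bind_pmf catalan_pmf (\<lambda>x. map_pmf ((#) x) renewal_pmf))"
proof -
  have "bind_pmf (map_pmf Suc (geometric_pmf (1/2))) (\<lambda>n. replicate_pmf n catalan_pmf) =
      bind_pmf catalan_pmf (\<lambda>x. map_pmf ((#) x) renewal_pmf)"
    unfolding renewal_pmf_def map_pmf_def bind_assoc_pmf bind_return_pmf replicate_pmf.simps
    by (subst bind_commute_pmf) (rule refl)
  then show ?thesis
    unfolding renewal_pmf_def
    by (subst geometric_bind_pmf_unfold)
       (auto simp: bind_assoc_pmf bind_return_pmf renewal_pmf_def[symmetric] intro!: bind_pmf_cong)
qed

lemma set_renewal_pmf: "xs \<in> set_pmf renewal_pmf \<Longrightarrow> x \<in> set xs \<Longrightarrow> 1 \<le> x"
  using set_catalan_pmf by (auto simp: renewal_pmf_def set_replicate_pmf)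

lemma pmf_replicate_pmf:
  "pmf (replicate_pmf n p) xs = (if length xs = n then prod_list (map (pmf p) xs) else 0)"
proof (induction n arbitrary: xs)
  case 0
  show ?case by (auto simp: indicator_def)
next
  case (Suc n)
  have e: "replicate_pmf (Suc n) p = map_pmf (\<lambda>(x, xs). x # xs) (pair_pmf p (replicate_pmf n p))"
    by (simp add: pair_pmf_def map_pmf_def bind_assoc_pmf bind_return_pmf)
  show ?case
  proof (cases xs)
    case Nil
    have "[] \<notin> set_pmf (replicate_pmf (Suc n) p)" by (subst set_replicate_pmf) simp
    then show ?thesis using Nil by (simp add: set_pmf_iff del: replicate_pmf.simps)
  next
    case (Cons y ys)
    have "inj (\<lambda>(x, xs). x # xs)" by (auto simp: inj_def)
    from pmf_map_inj'[OF this, of "pair_pmf p (replicate_pmf n p)" "(y, ys)"]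
    have "pmf (replicate_pmf (Suc n) p) xs = pmf p y * pmf (replicate_pmf n p) ys"
      unfolding e by (simp add: Cons pmf_pair)
    then show ?thesis using Suc by (simp add: Cons)
  qed
qed

lemma pmf_renewal_pmf:
  "pmf renewal_pmf xs = (1/2) ^ Suc (length xs) * prod_list (map catalan_law xs)"
proof -
  have "pmf renewal_pmf xs =
      (\<integral>n. pmf (replicate_pmf n catalan_pmf) xs \<partial>measure_pmf (geometric_pmf (1/2)))"
    unfolding renewal_pmf_def pmf_bind ..
  also have "\<dots> = (\<Sum>n\<in>{length xs}. pmf (replicate_pmf n catalan_pmf) xs * pmf (geometric_pmf (1/2)) n)"
    by (rule integral_measure_pmf_real) (auto simp: pmf_replicate_pmf split: if_splits)
  also have "\<dots> = (1/2) ^ Suc (length xs) * prod_list (map catalan_law xs)"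
    by (simp add: pmf_replicate_pmf pmf_catalan_pmf[abs_def])
  finally show ?thesis .
qed

text \<open>Effect of a first step \<open>x\<close> on the marked renewal epochs: later marks move
  by \<open>x\<close>, and only a unit step leaves a mark of its own, at \<open>1\<close>.\<close>

definition renew :: "nat \<Rightarrow> nat set \<Rightarrow> nat set" where
  "renew x A = (if x = 1 then prepend_fix 1 A else (+) x ` A)"

fun unit_renewals :: "nat list \<Rightarrow> nat set" where
  "unit_renewals [] = {}"
| "unit_renewals (x # xs) = renew x (unit_renewals xs)"

lemma finite_unit_renewals [simp]: "finite (unit_renewals xs)"
  by (induction xs) (auto simp: renew_def prepend_fix_def)

lemma zero_notin_unit_renewals: "(\<And>x. x \<in> set xs \<Longrightarrow> 1 \<le> x) \<Longrightarrow> 0 \<notin> unit_renewals xs"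
proof (induction xs)
  case (Cons x xs)
  then have "1 \<le> x" by simp
  then show ?case by (auto simp: renew_def prepend_fix_def)
qed simp

definition fix_pmf :: "nat set pmf" where
  "fix_pmf = map_pmf unit_renewals renewal_pmf"

lemma set_fix_pmf: "A \<in> set_pmf fix_pmf \<Longrightarrow> finite A \<and> 0 \<notin> A"
  using set_renewal_pmf by (auto simp: fix_pmf_def intro!: zero_notin_unit_renewals)

lemma fix_pmf_unfold:
  "fix_pmf = bind_pmf (bernoulli_pmf (1/2)) (\<lambda>b. if b then return_pmf {}
     else bind_pmf catalan_pmf (\<lambda>x. map_pmf (renew x) fix_pmf))"
  unfolding fix_pmf_def
  by (subst renewal_pmf_unfold)
     (auto simp: map_bind_pmf map_pmf_comp intro!: bind_pmf_cong)

lemma pmf_fix_pmf_unfold: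
  "pmf fix_pmf A = (if A = {} then 1/2 else 0) +
     1/2 * (\<integral>x. pmf (map_pmf (renew x) fix_pmf) A \<partial>measure_pmf catalan_pmf)"
  by (subst fix_pmf_unfold) (auto simp: pmf_bind indicator_def)

lemma pmf_map_eqI:
  assumes "\<And>x. x \<in> set_pmf p \<Longrightarrow> f x = y \<longleftrightarrow> x = z"
  shows "pmf (map_pmf f p) y = pmf p z"
proof -
  have "measure p (f -` {y}) = measure p {z}"
    by (rule measure_pmf.finite_measure_eq_AE) (use assms in \<open>auto simp: AE_measure_pmf_iff\<close>)
  then show ?thesis by (simp add: pmf_map measure_pmf_single)
qed

lemma pmf_map_eq_0I:
  assumes "\<And>x. x \<in> set_pmf p \<Longrightarrow> f x \<noteq> y"
  shows "pmf (map_pmf f p) y = 0"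
  using assms by (auto simp: pmf_eq_0_set_pmf)

text \<open>Without marks the process stops at once or takes a step other than \<open>1\<close>, of
  probability \<open>1/2\<close>, and restarts: \<open>q = 1/2 + 1/2 * 1/2 * q\<close>.\<close>

lemma pmf_fix_pmf_empty: "pmf fix_pmf {} = 2/3"
proof -
  have "pmf (map_pmf (renew x) fix_pmf) {} = pmf fix_pmf {} * indicator (- {1}) x" for x
  proof (cases "x = 1")
    case True
    then have "pmf (map_pmf (renew x) fix_pmf) {} = 0"
      by (intro pmf_map_eq_0I) (auto simp: renew_def prepend_fix_def)
    then show ?thesis using True by simp
  next
    case False
    then have "pmf (map_pmf (renew x) fix_pmf) {} = pmf fix_pmf {}"
      by (intro pmf_map_eqI) (auto simp: renew_def)
    then show ?thesis using False by simp
  qed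
  then have "(\<integral>x. pmf (map_pmf (renew x) fix_pmf) {} \<partial>measure_pmf catalan_pmf) =
      pmf fix_pmf {} * measure catalan_pmf (- {1})"
    by simp
  also have "measure catalan_pmf (- {1}) = 1 - measure catalan_pmf {1}"
    using measure_pmf.prob_compl[of "{1}" catalan_pmf] by (simp add: Compl_eq_Diff_UNIV)
  also have "\<dots> = 1/2" using catalan_law_1 by (simp add: measure_pmf_single pmf_catalan_pmf)
  finally show ?thesis using pmf_fix_pmf_unfold[of "{}"] by simp
qed

lemma pmf_map_renew_prepend:
  assumes "0 \<notin> A" "1 \<le> x"
  shows "pmf (map_pmf (renew x) fix_pmf) (prepend_fix (Suc k) A) =
    (if x = 1 then if k = 0 then pmf fix_pmf A else 0
     else if x \<le> k then pmf fix_pmf (prepend_fix (Suc (k - x)) A) else 0)"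
proof (cases "x = 1")
  case True
  show ?thesis
  proof (cases "k = 0")
    case True
    have "renew x S = prepend_fix (Suc k) A \<longleftrightarrow> S = A" if "S \<in> set_pmf fix_pmf" for S
      using join_prepend_eq_iff[of "{}" 0 S A] set_fix_pmf[OF that] assms \<open>x = 1\<close> True
      by (simp add: renew_def)
    then have "pmf (map_pmf (renew x) fix_pmf) (prepend_fix (Suc k) A) = pmf fix_pmf A"
      by (rule pmf_map_eqI)
    then show ?thesis using True \<open>x = 1\<close> by simp
  next
    case False
    have "renew x S \<noteq> prepend_fix (Suc k) A" for S
    proof -
      have "1 \<in> renew x S" using \<open>x = 1\<close> by (simp add: renew_def prepend_fix_def)
      moreover have "1 \<notin> prepend_fix (Suc k) A" using False by (auto simp: prepend_fix_def)
      ultimately show ?thesis by metis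
    qed
    then show ?thesis using False \<open>x = 1\<close> by (simp add: pmf_map_eq_0I)
  qed
next
  case False
  show ?thesis
  proof (cases "x \<le> k")
    case True
    have "prepend_fix (Suc k) A = (+) x ` prepend_fix (Suc (k - x)) A"
      using True by (auto simp: prepend_fix_def image_image)
    then have "renew x S = prepend_fix (Suc k) A \<longleftrightarrow> S = prepend_fix (Suc (k - x)) A" for S
      using False by (simp add: renew_def inj_image_eq_iff)
    then have "pmf (map_pmf (renew x) fix_pmf) (prepend_fix (Suc k) A) =
        pmf fix_pmf (prepend_fix (Suc (k - x)) A)"
      by (rule pmf_map_eqI)
    then show ?thesis using True False by simp
  next
    case 2: False
    have "renew x S \<noteq> prepend_fix (Suc k) A" if "S \<in> set_pmf fix_pmf" for S
    proof -
      \<comment> \<open>For \<open>x > k\<close> the epoch \<open>Suc k\<close> could only be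
        \<open>x + 0\<close>, and \<open>0\<close> is never a mark.\<close>
      have "Suc k \<notin> renew x S" using False 2 set_fix_pmf[OF that] by (auto simp: renew_def) (metis le_add1 le_Suc_eq add_eq_self_zero not_less_eq_eq)
      moreover have "Suc k \<in> prepend_fix (Suc k) A" by (simp add: prepend_fix_def)
      ultimately show ?thesis by metis
    qed
    then show ?thesis using False 2 by (simp add: pmf_map_eq_0I)
  qed
qed

text \<open>Condition on the first step \<open>Suc i\<close>. The induction hypothesis handles the
  remaining gap, the powers of \<open>1/4\<close> combine to a common factor, and what is left is
  the sum in \<open>fine_renewal\<close>.\<close>

lemma pmf_fix_pmf_prepend:
  assumes "0 \<notin> A"
  shows "pmf fix_pmf (prepend_fix (Suc k) A) = real (fixcount k {}) * (1/4) ^ Suc k * pmf fix_pmf A"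
proof (induction k rule: less_induct)
  case (less k)
  let ?g = "\<lambda>x. pmf (map_pmf (renew x) fix_pmf) (prepend_fix (Suc k) A)"
  have ne: "prepend_fix (Suc k) A \<noteq> {}" by (simp add: prepend_fix_def)
  have q: "pmf fix_pmf (prepend_fix (Suc k) A) = 1/2 * (\<integral>x. ?g x \<partial>measure_pmf catalan_pmf)"
    using ne by (subst pmf_fix_pmf_unfold) simp
  show ?case
  proof (cases k)
    \<comment> \<open>Only a unit first step marks \<open>1\<close>. The value
      \<open>fixcount 0 {} = 1\<close> comes from \<open>catalan_first_fixpt\<close> with its empty
      sum.\<close>
    case 0
    have "(\<integral>x. ?g x \<partial>measure_pmf catalan_pmf) = (\<Sum>x\<in>{1}. ?g x * pmf catalan_pmf x)"
    proof (rule integral_measure_pmf_real)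
      fix x assume "x \<in> set_pmf catalan_pmf" "?g x \<noteq> 0"
      then show "x \<in> {1}"
        using pmf_map_renew_prepend[OF assms set_catalan_pmf, of x k] set_catalan_pmf[of x] 0
        by (auto split: if_splits)
    qed simp
    also have "\<dots> = pmf fix_pmf A / 2"
      using 0 catalan_law_1 by (simp add: pmf_map_renew_prepend[OF assms] pmf_catalan_pmf)
    finally show ?thesis using q 0 catalan_first_fixpt[of 0] by simp
  next
    case (Suc m)
    have "(\<integral>x. ?g x \<partial>measure_pmf catalan_pmf) = (\<Sum>x\<in>{2..k}. ?g x * pmf catalan_pmf x)"
    proof (rule integral_measure_pmf_real)
      fix x assume "x \<in> set_pmf catalan_pmf" "?g x \<noteq> 0"
      then show "x \<in> {2..k}"
        using pmf_map_renew_prepend[OF assms set_catalan_pmf, of x k] set_catalan_pmf[of x] Suc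
        by (auto split: if_splits)
    qed simp
    also have "\<dots> = (\<Sum>i\<in>{1..m}. ?g (Suc i) * catalan_law (Suc i))"
      unfolding pmf_catalan_pmf by (rule sum.reindex_bij_witness[of _ Suc "\<lambda>i. i - 1"]) (auto simp: Suc)
    finally have "pmf fix_pmf (prepend_fix (Suc k) A) =
        (\<Sum>i\<in>{1..m}. ?g (Suc i) * (catalan_law (Suc i) / 2))"
      using q by (simp add: sum_divide_distrib)
    also have "\<dots> = (\<Sum>i\<in>{1..m}. catalan i * real (fixcount (m - i) {}) * ((1/4) ^ Suc k * pmf fix_pmf A))"
    proof (rule sum.cong[OF refl])
      fix i assume i: "i \<in> {1..m}"
      then have "?g (Suc i) = pmf fix_pmf (prepend_fix (Suc (m - i)) A)"
        using Suc by (subst pmf_map_renew_prepend[OF assms]) auto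
      also have "\<dots> = real (fixcount (m - i) {}) * (1/4) ^ Suc (m - i) * pmf fix_pmf A"
        using i Suc by (intro less) auto
      finally have g: "?g (Suc i) = real (fixcount (m - i) {}) * (1/4) ^ Suc (m - i) * pmf fix_pmf A" .
      have "Suc k = Suc (m - i) + Suc i" using i Suc by auto
      then have "(1/4 :: real) ^ Suc k = (1/4) ^ Suc (m - i) * (1/4) ^ Suc i"
        by (simp only: power_add)
      then show "?g (Suc i) * (catalan_law (Suc i) / 2) =
          catalan i * real (fixcount (m - i) {}) * ((1/4) ^ Suc k * pmf fix_pmf A)"
        unfolding catalan_law_Suc g by (simp only: mult_ac)
    qed
    also have "\<dots> = (\<Sum>i\<in>{1..m}. catalan i * real (fixcount (m - i) {})) * ((1/4) ^ Suc k * pmf fix_pmf A)"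
      by (simp only: sum_distrib_right)
    also have "(\<Sum>i\<in>{1..m}. catalan i * real (fixcount (m - i) {})) = real (fixcount k {})"
      using fine_renewal[OF catalan_first_fixpt, of m] Suc by simp
    finally show ?thesis by (simp only: mult.assoc)
  qed
qed

text \<open>Positive steps make the epochs distinct, so the point masses never pile up and their sum
  is an indicator. In the induction the first step shifts the measure of the remaining list.\<close>

lemma limit_measure_list:
  assumes "\<And>x. x \<in> set xs \<Longrightarrow> 1 \<le> x"
  shows "limit_measure (length xs) (\<lambda>j. xs ! (j - 1)) = indicat_real (unit_renewals xs)"
  using assms
proof (induction xs)
  case Nil
  show ?case by (auto simp: limit_measure_def)
next
  case (Cons x xs)
  let ?X = "\<lambda>j. (x # xs) ! (j - 1)" and ?Y = "\<lambda>j. xs ! (j - 1)" and ?n = "length xs"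
  have IH: "limit_measure ?n ?Y = indicat_real (unit_renewals xs)" using Cons by simp
  have z: "0 \<notin> unit_renewals xs" using Cons.prems by (intro zero_notin_unit_renewals) auto
  have x: "1 \<le> x" using Cons.prems by simp
  show ?case
  proof
    fix y
    have shift: "(\<Sum>k=1..Suc ?n. f k) = f 1 + (\<Sum>k=1..?n. f (Suc k))" for f :: "nat \<Rightarrow> real"
      by (subst sum.atLeast_Suc_atMost) (simp_all add: sum.shift_bounds_cl_Suc_ivl del: sum.cl_ivl_Suc)
    have ps: "(\<Sum>j=1..Suc k. ?X j) = x + (\<Sum>j=1..k. ?Y j)" for k
    proof -
      have "(\<Sum>j=1..Suc k. ?X j) = ?X 1 + (\<Sum>j=1..k. ?X (Suc j))"
        by (subst sum.atLeast_Suc_atMost) (simp_all add: sum.shift_bounds_cl_Suc_ivl del: sum.cl_ivl_Suc)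
      also have "(\<Sum>j=1..k. ?X (Suc j)) = (\<Sum>j=1..k. ?Y j)"
        by (rule sum.cong) (auto simp: nth_Cons')
      finally show ?thesis by simp
    qed
    have "limit_measure (length (x # xs)) ?X y =
        (if x = 1 then delta x y else 0) + (\<Sum>k=1..?n. if ?X (Suc k) = 1 then delta (\<Sum>j=1..Suc k. ?X j) y else 0)"
      unfolding limit_measure_def length_Cons shift by simp
    also have "(\<Sum>k=1..?n. if ?X (Suc k) = 1 then delta (\<Sum>j=1..Suc k. ?X j) y else 0) =
        (\<Sum>k=1..?n. if x \<le> y then (if ?Y k = 1 then delta (\<Sum>j=1..k. ?Y j) (y - x) else 0) else 0)"
      unfolding ps by (rule sum.cong) (auto simp: delta_def nth_Cons')
    also have "\<dots> = (if x \<le> y then limit_measure ?n ?Y (y - x) else 0)"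
      by (cases "x \<le> y") (simp_all only: limit_measure_def if_True if_False sum.neutral_const)
    also have "\<dots> = indicat_real ((+) x ` unit_renewals xs) y"
      unfolding IH by (auto simp: indicator_def image_iff)
    also have "(if x = 1 then delta x y else 0) + indicat_real ((+) x ` unit_renewals xs) y =
        indicat_real (unit_renewals (x # xs)) y"
      using z by (auto simp: renew_def prepend_fix_def delta_def indicator_def)
    finally show "limit_measure (length (x # xs)) ?X y = indicat_real (unit_renewals (x # xs)) y" .
  qed
qed

section \<open>From permutations to the limit\<close>

text \<open>The limit also has mass 1, so no mass escapes; the difference of expectations is at most
  \<open>B\<close> times the \<open>L1\<close> distance of the mass functions.\<close>

lemma expectation_tendsto_of_pmf_tendsto:
  fixes p :: "nat \<Rightarrow> 'a pmf" and h :: "'a \<Rightarrow> real"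
  assumes lim: "\<And>x. (\<lambda>n. pmf (p n) x) \<longlonglongrightarrow> pmf q x" and h: "\<And>x. \<bar>h x\<bar> \<le> B"
  shows "(\<lambda>n. measure_pmf.expectation (p n) h) \<longlonglongrightarrow> measure_pmf.expectation q h"
proof -
  let ?M = "count_space (UNIV :: 'a set)"
  have [simp]: "integrable ?M (pmf r)" for r by (rule integrable_pmf)
  have e: "measure_pmf.expectation r h = (\<integral>x. pmf r x * h x \<partial>?M)" for r
    unfolding measure_pmf_eq_density by (subst integral_density) (auto simp: pmf_nonneg)
  have int: "integrable ?M (\<lambda>x. pmf r x * h x)" for r
  proof (rule Bochner_Integration.integrable_bound[of _ "\<lambda>x. pmf r x * B"])
    show "AE x in ?M. norm (pmf r x * h x) \<le> norm (pmf r x * B)"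
      using h by (intro AE_I2) (auto simp: abs_mult intro!: mult_left_mono order_trans[OF h abs_ge_self])
  qed auto
  have nn: "(\<integral>\<^sup>+ x. ennreal (norm (pmf r x)) \<partial>?M) = 1" for r
    by (simp add: nn_integral_pmf pmf_nonneg)
  have "(\<lambda>n. \<integral>\<^sup>+ x. norm (pmf (p n) x - pmf q x) \<partial>?M) \<longlonglongrightarrow> 0"
    by (rule Scheffe_lemma2) (use lim in \<open>auto simp: nn simp del: real_norm_def\<close>)
  moreover have "(\<integral>\<^sup>+ x. norm (pmf (p n) x - pmf q x) \<partial>?M) =
      ennreal (\<integral>x. \<bar>pmf (p n) x - pmf q x\<bar> \<partial>?M)" for n
    by (subst nn_integral_eq_integral) auto
  ultimately have "(\<lambda>n. ennreal (\<integral>x. \<bar>pmf (p n) x - pmf q x\<bar> \<partial>?M)) \<longlonglongrightarrow> ennreal 0" by simp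
  then have "(\<lambda>n. \<integral>x. \<bar>pmf (p n) x - pmf q x\<bar> \<partial>?M) \<longlonglongrightarrow> 0"
    by (subst (asm) tendsto_ennreal_iff) auto
  then have tv: "(\<lambda>n. (\<integral>x. \<bar>pmf (p n) x - pmf q x\<bar> \<partial>?M) * B) \<longlonglongrightarrow> 0"
    by (rule tendsto_mult_left_zero)
  have "norm (measure_pmf.expectation (p n) h - measure_pmf.expectation q h) \<le>
      (\<integral>x. \<bar>pmf (p n) x - pmf q x\<bar> \<partial>?M) * B" for n
  proof -
    have "measure_pmf.expectation (p n) h - measure_pmf.expectation q h =
        (\<integral>x. pmf (p n) x * h x - pmf q x * h x \<partial>?M)"
      unfolding e by (rule Bochner_Integration.integral_diff[symmetric]) (rule int)+
    also have "norm \<dots> \<le> (\<integral>x. norm (pmf (p n) x * h x - pmf q x * h x) \<partial>?M)"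
      by (rule integral_norm_bound)
    also have "\<dots> \<le> (\<integral>x. \<bar>pmf (p n) x - pmf q x\<bar> * B \<partial>?M)"
    proof (rule integral_mono)
      fix x
      have "norm (pmf (p n) x * h x - pmf q x * h x) = \<bar>pmf (p n) x - pmf q x\<bar> * \<bar>h x\<bar>"
        by (simp add: abs_mult[symmetric] left_diff_distrib)
      also have "\<dots> \<le> \<bar>pmf (p n) x - pmf q x\<bar> * B" by (intro mult_left_mono h) simp
      finally show "norm (pmf (p n) x * h x - pmf q x * h x) \<le> \<bar>pmf (p n) x - pmf q x\<bar> * B" .
    qed (auto intro!: int)
    also have "\<dots> = (\<integral>x. \<bar>pmf (p n) x - pmf q x\<bar> \<partial>?M) * B" by simp
    finally show ?thesis .
  qed
  then have "(\<lambda>n. measure_pmf.expectation (p n) h - measure_pmf.expectation q h) \<longlonglongrightarrow> 0"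
    by (intro Lim_null_comparison[OF always_eventually tv]) blast
  then show ?thesis by (simp add: LIM_zero_iff)
qed

section \<open>Permutations as functions and as lists\<close>

definition perm_list :: "nat \<Rightarrow> (nat \<Rightarrow> nat) \<Rightarrow> nat list" where
  "perm_list n \<tau> = map \<tau> [1..<Suc n]"

lemma perm_list_nth: "i < n \<Longrightarrow> perm_list n \<tau> ! i = \<tau> (Suc i)"
  by (simp add: perm_list_def del: upt_Suc)

lemma length_perm_list [simp]: "length (perm_list n \<tau>) = n"
  by (simp add: perm_list_def del: upt_Suc)

lemma contains_pat321_iff:
  assumes "\<tau> permutes {1..n}"
  shows "contains_pattern pat321 3 \<tau> n \<longleftrightarrow> \<not> no321 (perm_list n \<tau>)"
proof
  assume "contains_pattern pat321 3 \<tau> n"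
  then obtain idx where mono: "strict_mono_on {1..3} idx" and sub: "idx ` {1..3} \<subseteq> {1..n}"
    and pat: "\<forall>s\<in>{1..3}. \<forall>t\<in>{1..3}. s < t \<longrightarrow> (\<tau> (idx s) < \<tau> (idx t) \<longleftrightarrow> pat321 s < pat321 t)"
    unfolding contains_pattern_def by blast
  have lt: "idx 1 < idx 2" "idx 2 < idx 3" using mono by (auto simp: strict_mono_on_def)
  have "idx 1 \<in> {1..n}" "idx 2 \<in> {1..n}" "idx 3 \<in> {1..n}"
    by (rule subsetD[OF sub], rule imageI, simp)+
  then obtain i j k where ijk: "idx 1 = Suc i" "idx 2 = Suc j" "idx 3 = Suc k" "k < n"
    by (metis Suc_le_D Suc_le_eq atLeastAtMost_iff One_nat_def)
  have "\<not> \<tau> (idx 1) < \<tau> (idx 2)" "\<not> \<tau> (idx 2) < \<tau> (idx 3)"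
    using pat[rule_format, of 1 2] pat[rule_format, of 2 3] by (auto simp: pat321_def)
  \<comment> \<open>The pattern only denies the ascents; injectivity of \<open>\<tau>\<close> makes
    the descents strict.\<close>
  moreover have "\<tau> (idx 1) \<noteq> \<tau> (idx 2)" "\<tau> (idx 2) \<noteq> \<tau> (idx 3)"
    unfolding inj_eq[OF permutes_inj[OF assms]] using lt by simp_all
  ultimately have "\<tau> (Suc i) > \<tau> (Suc j)" "\<tau> (Suc j) > \<tau> (Suc k)" using ijk by auto
  moreover have "i < j" "j < k" using lt ijk by auto
  ultimately show "\<not> no321 (perm_list n \<tau>)"
    using no321_iff_nth[THEN iffD1, rule_format, of "perm_list n \<tau>" i j k] \<open>k < n\<close>
    by (auto simp: perm_list_nth)
next
  assume "\<not> no321 (perm_list n \<tau>)"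
  then obtain i j k where ijk: "i < j" "j < k" "k < n"
    "perm_list n \<tau> ! i > perm_list n \<tau> ! j" "perm_list n \<tau> ! j > perm_list n \<tau> ! k"
    unfolding no321_iff_nth by auto
  then have \<tau>: "\<tau> (Suc i) > \<tau> (Suc j)" "\<tau> (Suc j) > \<tau> (Suc k)" by (auto simp: perm_list_nth)
  define idx where "idx = (\<lambda>s::nat. if s = 1 then Suc i else if s = 2 then Suc j else Suc k)"
  have three: "{1..3} = {1, 2, 3::nat}" by auto
  have "strict_mono_on {1..3} idx" using ijk by (auto simp: strict_mono_on_def idx_def three)
  moreover have "idx ` {1..3} \<subseteq> {1..n}" using ijk by (auto simp: idx_def)
  moreover have "\<forall>s\<in>{1..3}. \<forall>t\<in>{1..3}. s < t \<longrightarrow> (\<tau> (idx s) < \<tau> (idx t) \<longleftrightarrow> pat321 s < pat321 t)"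
    using \<tau> by (auto simp: three idx_def pat321_def)
  ultimately show "contains_pattern pat321 3 \<tau> n" unfolding contains_pattern_def by blast
qed

lemma bij_betw_perm_list: "bij_betw (perm_list n) (Av n pat321 3) (perms321 n)"
  unfolding bij_betw_def
proof (intro conjI equalityI subsetI inj_onI)
  fix \<sigma> \<tau> assume "\<sigma> \<in> Av n pat321 3" "\<tau> \<in> Av n pat321 3" and eq: "perm_list n \<sigma> = perm_list n \<tau>"
  then have p: "\<sigma> permutes {1..n}" "\<tau> permutes {1..n}" by (auto simp: Av_def)
  show "\<sigma> = \<tau>"
  proof
    fix x show "\<sigma> x = \<tau> x"
    proof (cases "x \<in> {1..n}")
      case True
      then show ?thesis using perm_list_nth[of "x - 1" n] eq by (metis Suc_diff_1 Suc_le_eq atLeastAtMost_iff One_nat_def)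
    qed (use p in \<open>auto simp: permutes_def\<close>)
  qed
next
  fix xs assume "xs \<in> perm_list n ` Av n pat321 3"
  then obtain \<tau> where \<tau>: "\<tau> permutes {1..n}" "\<not> contains_pattern pat321 3 \<tau> n" "xs = perm_list n \<tau>"
    by (auto simp: Av_def)
  have u: "set [1..<Suc n] = {1..n}" by auto
  have "set xs = {1..n}" using \<tau> permutes_image[OF \<tau>(1)] u by (simp only: perm_list_def set_map)
  moreover have "distinct xs" using \<tau> permutes_inj_on[OF \<tau>(1)]
    by (simp add: perm_list_def distinct_map del: upt_Suc)
  ultimately show "xs \<in> perms321 n" using \<tau> contains_pat321_iff[OF \<tau>(1)] by (simp add: perms321_def)
next
  fix xs assume xs: "xs \<in> perms321 n"
  \<comment> \<open>Outside \<open>{1..n}\<close> the identity is forced by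
    \<open>permutes\<close>.\<close>
  define \<tau> where "\<tau> = (\<lambda>i. if i \<in> {1..n} then xs ! (i - 1) else i)"
  have len: "length xs = n" and d: "distinct xs" and st: "set xs = {1..n}"
    using xs perms321_length[OF xs] by (auto simp: perms321_def)
  have pl: "perm_list n \<tau> = xs"
    by (rule nth_equalityI) (auto simp: len perm_list_nth \<tau>_def)
  have "\<tau> permutes {1..n}"
  proof (rule bij_imp_permutes)
    have "inj_on \<tau> {1..n}"
      using d len by (auto simp: inj_on_def \<tau>_def nth_eq_iff_index_eq)
    moreover have "\<tau> ` {1..n} = {1..n}"
    proof -
      have "set [1..<Suc n] = {1..n}" by auto
      then have "\<tau> ` {1..n} = set (perm_list n \<tau>)" unfolding perm_list_def set_map by (simp only:)
      then show ?thesis using st pl by simp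
    qed
    ultimately show "bij_betw \<tau> {1..n} {1..n}" by (simp add: bij_betw_def)
  qed (auto simp: \<tau>_def)
  then have "\<tau> \<in> Av n pat321 3" using contains_pat321_iff pl xs by (auto simp: Av_def perms321_def)
  then show "xs \<in> perm_list n ` Av n pat321 3" using pl by (metis image_eqI)
qed

section \<open>Fixed points in the two halves\<close>

definition left_half :: "nat \<Rightarrow> nat set \<Rightarrow> nat set" where
  "left_half n F = F \<inter> {1..n div 2}"

definition right_half :: "nat \<Rightarrow> nat set \<Rightarrow> nat set" where
  "right_half n F = reflect n (F \<inter> {n div 2 + 1..n})"

text \<open>For fixed finite \<open>A\<close> and \<open>B\<close> the size conditions hold
  eventually, and then the joint event prescribes the entire fixed-point set, as
  \<open>fixcount\<close> requires.\<close>

lemma halves_eq_iff: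
  assumes "F \<subseteq> {1..n}" "A \<subseteq> {1..n div 2}" "B \<subseteq> {1..n - n div 2}"
  shows "left_half n F = A \<and> right_half n F = B \<longleftrightarrow> F = A \<union> reflect n B"
proof
  assume l: "left_half n F = A \<and> right_half n F = B"
  have "F \<inter> {n div 2 + 1..n} = reflect n (reflect n (F \<inter> {n div 2 + 1..n}))"
    by (rule reflect_reflect[symmetric]) auto
  then have "F \<inter> {n div 2 + 1..n} = reflect n B" using l by (simp add: right_half_def)
  moreover have "F = F \<inter> {1..n div 2} \<union> F \<inter> {n div 2 + 1..n}" using assms(1) by auto
  ultimately show "F = A \<union> reflect n B" using l by (simp add: left_half_def)
next
  assume r: "F = A \<union> reflect n B"
  have B: "reflect n B \<subseteq> {n div 2 + 1..n}"
  proof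
    fix i assume "i \<in> reflect n B"
    then obtain b where "b \<in> B" "i = n + 1 - b" by (auto simp: reflect_def)
    then show "i \<in> {n div 2 + 1..n}" using assms(3) by fastforce
  qed
  have "F \<inter> {1..n div 2} = A" using B assms(2) unfolding r by fastforce
  moreover have "F \<inter> {n div 2 + 1..n} = reflect n B" using B assms(2) unfolding r by fastforce
  moreover have "reflect n (reflect n B) = B"
  proof (rule reflect_reflect)
    show "B \<subseteq> {1..n}" using assms(3) by (rule order_trans) auto
  qed
  ultimately show "left_half n F = A \<and> right_half n F = B" by (simp add: left_half_def right_half_def)
qed

lemma fixpts_perm_list: "fixpts (perm_list n \<tau>) = {i \<in> {1..n}. \<tau> i = i}"
proof -
  have "perm_list n \<tau> ! (i - 1) = \<tau> i" if "1 \<le> i" "i \<le> n" for i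
    using that perm_list_nth[of "i - 1" n \<tau>] by simp
  then show ?thesis by (auto simp: fixpts_def)
qed

lemma fix_left_eq: "fix_left n \<tau> = indicat_real (left_half n (fixpts (perm_list n \<tau>)))"
proof
  fix x
  have "fix_left n \<tau> x = (\<Sum>i\<in>{1..n div 2}. if i = x then (if \<tau> x = x then 1 else 0) else 0)"
    unfolding fix_left_def by (rule sum.cong) (auto simp: delta_def)
  also have "\<dots> = (if x \<in> {1..n div 2} then if \<tau> x = x then 1 else 0 else 0)"
    by (rule sum.delta) simp
  also have "\<dots> = indicat_real (left_half n (fixpts (perm_list n \<tau>))) x"
    unfolding fixpts_perm_list by (auto simp: left_half_def indicator_def)
  finally show "fix_left n \<tau> x = indicat_real (left_half n (fixpts (perm_list n \<tau>))) x" .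
qed

lemma fix_right_eq: "fix_right n \<tau> = indicat_real (right_half n (fixpts (perm_list n \<tau>)))"
proof
  fix x
  let ?S = "{n div 2 + 1..n}"
  have mem: "x \<in> right_half n (fixpts (perm_list n \<tau>)) \<longleftrightarrow>
      n + 1 - x \<in> ?S \<and> 1 \<le> x \<and> \<tau> (n + 1 - x) = n + 1 - x"
  proof
    assume "x \<in> right_half n (fixpts (perm_list n \<tau>))"
    then obtain i where "i \<in> ?S" "\<tau> i = i" "x = n + 1 - i"
      unfolding right_half_def reflect_def fixpts_perm_list by auto
    then show "n + 1 - x \<in> ?S \<and> 1 \<le> x \<and> \<tau> (n + 1 - x) = n + 1 - x" by auto
  next
    assume "n + 1 - x \<in> ?S \<and> 1 \<le> x \<and> \<tau> (n + 1 - x) = n + 1 - x"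
    then show "x \<in> right_half n (fixpts (perm_list n \<tau>))"
      unfolding right_half_def reflect_def fixpts_perm_list
      by (intro image_eqI[of _ _ "n + 1 - x"]) auto
  qed
  have "fix_right n \<tau> x =
      (\<Sum>i\<in>?S. if i = n + 1 - x then (if 1 \<le> x \<and> \<tau> (n + 1 - x) = n + 1 - x then 1 else 0) else 0)"
    unfolding fix_right_def by (rule sum.cong) (auto simp: delta_def)
  also have "\<dots> = (if n + 1 - x \<in> ?S then if 1 \<le> x \<and> \<tau> (n + 1 - x) = n + 1 - x then 1 else 0 else 0)"
    by (rule sum.delta) simp
  also have "\<dots> = indicat_real (right_half n (fixpts (perm_list n \<tau>))) x"
    unfolding indicator_def mem by auto
  finally show "fix_right n \<tau> x = indicat_real (right_half n (fixpts (perm_list n \<tau>))) x" .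
qed

lemma map_pmf_of_set_Av: "map_pmf (perm_list n) (pmf_of_set (Av n pat321 3)) = pmf_of_set (perms321 n)"
proof -
  have "finite (Av n pat321 3)" "Av n pat321 3 \<noteq> {}"
    using bij_betw_finite[OF bij_betw_perm_list[of n]] bij_betw_imp_surj_on[OF bij_betw_perm_list[of n]]
      perms321_nonempty[of n] by (auto simp del: perms321_nonempty)
  then show ?thesis by (intro map_pmf_of_set_bij_betw bij_betw_perm_list)
qed

definition halves_pmf :: "nat \<Rightarrow> (nat set \<times> nat set) pmf" where
  "halves_pmf n = map_pmf (\<lambda>xs. (left_half n (fixpts xs), right_half n (fixpts xs))) (pmf_of_set (perms321 n))"

lemma set_halves_pmf:
  assumes "(A, B) \<in> set_pmf (halves_pmf n)"
  shows "finite A \<and> 0 \<notin> A \<and> finite B \<and> 0 \<notin> B"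
  using assms by (auto simp: halves_pmf_def left_half_def right_half_def reflect_def)

lemma pmf_halves_tendsto:
  "(\<lambda>n. pmf (halves_pmf n) (A, B)) \<longlonglongrightarrow> pmf (pair_pmf fix_pmf fix_pmf) (A, B)"
proof (cases "finite A \<and> 0 \<notin> A \<and> finite B \<and> 0 \<notin> B")
  \<comment> \<open>Such a pair is outside the support of every law involved, so both sides are
    \<open>0\<close>.\<close>
  case False
  then have "pmf (halves_pmf n) (A, B) = 0" for n
    using set_halves_pmf by (auto simp: pmf_eq_0_set_pmf)
  moreover have "pmf (pair_pmf fix_pmf fix_pmf) (A, B) = 0"
    using False set_fix_pmf by (auto simp: pmf_eq_0_set_pmf)
  ultimately show ?thesis by simp
next
  case True
  have "\<forall>\<^sub>F n in sequentially. real (fixcount n (A \<union> reflect n B)) / catalan n = pmf (halves_pmf n) (A, B)"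
  proof (rule eventually_sequentiallyI)
    \<comment> \<open>The factor \<open>2\<close> fits \<open>A\<close> and \<open>B\<close> into
      the halves of \<open>{1..n}\<close>.\<close>
    fix n assume n: "2 * Max (insert 0 (A \<union> B)) \<le> n"
    have le: "x \<le> n div 2" "1 \<le> x" if "x \<in> A \<union> B" for x
    proof -
      have "x \<le> Max (insert 0 (A \<union> B))" using True that by (intro Max_ge) auto
      then show "x \<le> n div 2" using n by auto
      show "1 \<le> x" using that True by (cases x) auto
    qed
    have "n div 2 \<le> n - n div 2" by auto
    then have A: "A \<subseteq> {1..n div 2}" and B: "B \<subseteq> {1..n - n div 2}"
      using le by (fastforce intro: order_trans)+
    have "left_half n (fixpts xs) = A \<and> right_half n (fixpts xs) = B \<longleftrightarrow>
        fixpts xs = A \<union> reflect n B" if "xs \<in> perms321 n" for xs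
      using fixpts_subset[of xs] perms321_length[OF that] by (intro halves_eq_iff[OF _ A B]) simp
    then have "perms321 n \<inter> (\<lambda>xs. (left_half n (fixpts xs), right_half n (fixpts xs))) -` {(A, B)} =
        {xs \<in> perms321 n. fixpts xs = A \<union> reflect n B}"
      by auto
    then have "pmf (halves_pmf n) (A, B) = real (fixcount n (A \<union> reflect n B)) / real (card (perms321 n))"
      by (simp add: halves_pmf_def pmf_map measure_pmf_of_set fixcount_def)
    then show "real (fixcount n (A \<union> reflect n B)) / catalan n = pmf (halves_pmf n) (A, B)"
      by (simp add: card_perms321)
  qed
  moreover have "(\<lambda>n. real (fixcount n (A \<union> reflect n B)) / catalan n) \<longlonglongrightarrow> pmf fix_pmf A * pmf fix_pmf B"
    using True by (intro fixcount_two_sided_tendsto pmf_fix_pmf_empty pmf_fix_pmf_prepend) auto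
  ultimately show ?thesis unfolding pmf_pair by (rule Lim_transform_eventually[rotated])
qed

section \<open>The given random variables\<close>

lemma map_upt_Suc_eq_iff:
  "map f [1..<Suc n] = xs \<longleftrightarrow> n = length xs \<and> (\<forall>j\<in>{1..length xs}. f j = xs ! (j - 1))"
proof
  assume "map f [1..<Suc n] = xs"
  then have x: "xs = map f [1..<Suc n]" by simp
  have "length xs = n" unfolding x by (simp del: upt_Suc)
  moreover have "f j = xs ! (j - 1)" if "j \<in> {1..n}" for j
    using that unfolding x by (auto simp del: upt_Suc)
  ultimately show "n = length xs \<and> (\<forall>j\<in>{1..length xs}. f j = xs ! (j - 1))" by simp
next
  assume "n = length xs \<and> (\<forall>j\<in>{1..length xs}. f j = xs ! (j - 1))"
  then show "map f [1..<Suc n] = xs"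
    by (intro nth_equalityI) (auto simp del: upt_Suc)
qed

text \<open>The masses on \<open>k \<ge> 1\<close> already sum to \<open>1\<close>, so the value
  \<open>0\<close> has probability \<open>0\<close>, in agreement with
  \<open>catalan_law 0 = 0\<close>.\<close>

lemma (in prob_space) prob_catalan_law:
  assumes Z: "random_variable (count_space UNIV) Z"
    and law: "\<And>k. k \<ge> 1 \<Longrightarrow> prob {\<omega> \<in> space M. Z \<omega> = k} = catalan_law k"
  shows "prob {\<omega> \<in> space M. Z \<omega> = k} = catalan_law k"
proof (cases "k = 0")
  case True
  let ?A = "\<lambda>k. {\<omega> \<in> space M. Z \<omega> = k}"
  have "?A k = Z -` {k} \<inter> space M" for k by auto
  then have "range ?A \<subseteq> events" using measurable_sets[OF Z] by auto
  then have "(\<lambda>k. prob (?A k)) sums prob (\<Union>k. ?A k)"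
    by (rule finite_measure_UNION) (auto simp: disjoint_family_on_def)
  moreover have "(\<Union>k. ?A k) = space M" by auto
  ultimately have "(\<lambda>k. prob (?A k)) sums 1" by (simp add: prob_space)
  from sums_diff[OF this catalan_law_sums]
  have "(\<lambda>k. prob (?A k) - catalan_law k) sums 0" by simp
  moreover have "(\<lambda>k. prob (?A k) - catalan_law k) = (\<lambda>k. if k = 0 then prob (?A 0) else 0)"
    using law by (auto simp: fun_eq_iff)
  ultimately have "prob (?A 0) = 0"
    using sums_single[of 0 "\<lambda>_. prob (?A 0)"] by (auto dest: sums_unique2)
  then show ?thesis using True by simp
qed (use law in simp)

lemma indicator_mem_MF:
  assumes "finite A" "0 \<notin> A"
  shows "indicat_real A \<in> MF"
proof -
  have "summable (indicat_real A)" using assms(1) by (rule summable_finite) simp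
  then show ?thesis using assms by (simp add: MF_def)
qed

theorem theorem1p1:
  fixes P :: "'a measure"
    and X Y :: "nat \<Rightarrow> 'a \<Rightarrow> nat"
    and N M :: "'a \<Rightarrow> nat"
  assumes "prob_space P"
    and indep: "prob_space.indep_vars P (\<lambda>_. count_space UNIV)
       (\<lambda>i. case i of IX j \<Rightarrow> X j | IY j \<Rightarrow> Y j | IN \<Rightarrow> N | IM \<Rightarrow> M)
       ({IX j | j. j \<ge> 1} \<union> {IY j | j. j \<ge> 1} \<union> {IN, IM})"
    and distX: "\<And>i k. i \<ge> 1 \<Longrightarrow> k \<ge> 1 \<Longrightarrow>
       measure P {\<omega> \<in> space P. X i \<omega> = k} = catalan_law k"
    and distY: "\<And>i k. i \<ge> 1 \<Longrightarrow> k \<ge> 1 \<Longrightarrow>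
       measure P {\<omega> \<in> space P. Y i \<omega> = k} = catalan_law k"
    and distN: "\<And>k. measure P {\<omega> \<in> space P. N \<omega> = k} = 1 / 2 ^ (k + 1)"
    and distM: "\<And>k. measure P {\<omega> \<in> space P. M \<omega> = k} = 1 / 2 ^ (k + 1)"
  shows "\<forall>F :: (nat \<Rightarrow> real) \<times> (nat \<Rightarrow> real) \<Rightarrow> real.
     continuous_map (prod_topology MF_top MF_top) euclideanreal F \<and> bounded (F ` (MF \<times> MF)) \<longrightarrow>
     (\<lambda>n. measure_pmf.expectation (pmf_of_set (Av n pat321 3))
            (\<lambda>\<tau>. F (fix_left n \<tau>, fix_right n \<tau>)))
     \<longlonglongrightarrow> (\<integral>\<omega>. F (limit_measure (N \<omega>) (\<lambda>j. X j \<omega>), limit_measure (M \<omega>) (\<lambda>j. Y j \<omega>)) \<partial>P)"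
proof (intro allI impI, elim conjE)
  fix F :: "(nat \<Rightarrow> real) \<times> (nat \<Rightarrow> real) \<Rightarrow> real"
  assume bdd: "bounded (F ` (MF \<times> MF))"
  interpret prob_space P by fact
  let ?V = "\<lambda>i. case i of IX j \<Rightarrow> X j | IY j \<Rightarrow> Y j | IN \<Rightarrow> N | IM \<Rightarrow> M"
  let ?I = "{IX j | j. j \<ge> 1} \<union> {IY j | j. j \<ge> 1} \<union> {IN, IM}"
  \<comment> \<open>The limit depends on the variables only through these two finite lists.\<close>
  define L where "L = (\<lambda>\<omega>. (map (\<lambda>j. X j \<omega>) [1..<Suc (N \<omega>)], map (\<lambda>j. Y j \<omega>) [1..<Suc (M \<omega>)]))"
  have rv: "random_variable (count_space UNIV) (?V i)" if "i \<in> ?I" for i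
    using indep that unfolding indep_vars_def by blast
  have lawX: "prob {\<omega> \<in> space P. X j \<omega> = k} = catalan_law k" if "j \<ge> 1" for j k
  proof (rule prob_catalan_law[of "X j", OF _ distX])
    show "random_variable (count_space UNIV) (X j)" using rv[of "IX j"] that by simp
  qed (use that in auto)
  have lawY: "prob {\<omega> \<in> space P. Y j \<omega> = k} = catalan_law k" if "j \<ge> 1" for j k
  proof (rule prob_catalan_law[of "Y j", OF _ distY])
    show "random_variable (count_space UNIV) (Y j)" using rv[of "IY j"] that by simp
  qed (use that in auto)
  have fibre: "L -` {(xs, ys)} \<inter> space P \<in> events"
    "prob (L -` {(xs, ys)} \<inter> space P) = pmf renewal_pmf xs * pmf renewal_pmf ys" for xs ys
  proof -
    \<comment> \<open>A fibre of \<open>L\<close> fixes just \<open>N\<close>, \<open>M\<close> and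
      the steps they select, so finitely many independent variables are involved.\<close>
    let ?J1 = "IX ` {1..length xs}" and ?J2 = "IY ` {1..length ys}"
    let ?J = "{IN, IM} \<union> (?J1 \<union> ?J2)"
    let ?v = "\<lambda>i. case i of IX j \<Rightarrow> xs ! (j - 1) | IY j \<Rightarrow> ys ! (j - 1) | IN \<Rightarrow> length xs | IM \<Rightarrow> length ys"
    let ?E = "\<lambda>i. ?V i -` {?v i} \<inter> space P"
    have J: "?J \<subseteq> ?I" by auto
    have L: "L -` {(xs, ys)} \<inter> space P = (\<Inter>i\<in>?J. ?E i)"
    proof (rule set_eqI)
      fix \<omega>
      have "L \<omega> = (xs, ys) \<longleftrightarrow> (N \<omega> = length xs \<and> (\<forall>j\<in>{1..length xs}. X j \<omega> = xs ! (j - 1))) \<and>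
          (M \<omega> = length ys \<and> (\<forall>j\<in>{1..length ys}. Y j \<omega> = ys ! (j - 1)))"
        unfolding L_def prod.inject map_upt_Suc_eq_iff ..
      moreover have "\<omega> \<in> (\<Inter>i\<in>?J. ?E i) \<longleftrightarrow> \<omega> \<in> space P \<and>
          (N \<omega> = length xs \<and> (\<forall>j\<in>{1..length xs}. X j \<omega> = xs ! (j - 1))) \<and>
          (M \<omega> = length ys \<and> (\<forall>j\<in>{1..length ys}. Y j \<omega> = ys ! (j - 1)))"
        by (simp add: ball_Un) blast
      ultimately show "\<omega> \<in> L -` {(xs, ys)} \<inter> space P \<longleftrightarrow> \<omega> \<in> (\<Inter>i\<in>?J. ?E i)" by blast
    qed
    have "?E i \<in> events" if "i \<in> ?J" for i
      by (rule measurable_sets[OF rv[OF subsetD[OF J that]]]) simp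
    then show "L -` {(xs, ys)} \<inter> space P \<in> events"
      unfolding L by (intro sets.finite_INT) auto
    have "prob (\<Inter>i\<in>?J. ?E i) = (\<Prod>i\<in>?J. prob (?E i))"
      by (rule indep_varsD[OF indep _ _ J]) auto
    also have "\<dots> = (\<Prod>i\<in>{IN, IM}. prob (?E i)) * ((\<Prod>i\<in>?J1. prob (?E i)) * (\<Prod>i\<in>?J2. prob (?E i)))"
    proof -
      have "finite ?J1" "finite ?J2" "?J1 \<inter> ?J2 = {}" "{IN, IM} \<inter> (?J1 \<union> ?J2) = {}" by auto
      then show ?thesis by (simp only: prod.union_disjoint finite_Un finite.intros)
    qed
    also have "(\<Prod>i\<in>?J1. prob (?E i)) = prod_list (map catalan_law xs)"
    proof -
      have "(\<Prod>i\<in>?J1. prob (?E i)) = (\<Prod>j\<in>{1..length xs}. catalan_law (xs ! (j - 1)))"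
      proof -
        have "?E (IX j) = {\<omega> \<in> space P. X j \<omega> = xs ! (j - 1)}" for j by auto
        then have "prob (?E (IX j)) = catalan_law (xs ! (j - 1))" if "j \<in> {1..length xs}" for j
          using lawX that by simp
        moreover have "inj_on IX {1..length xs}" by (simp add: inj_on_def)
        ultimately show ?thesis by (simp only: prod.reindex o_def cong: prod.cong)
      qed
      also have "\<dots> = prod_list (map catalan_law xs)"
        by (subst prod.list_conv_set_nth) (rule prod.reindex_bij_witness[of _ Suc "\<lambda>i. i - 1"]; auto)
      finally show ?thesis .
    qed
    also have "(\<Prod>i\<in>?J2. prob (?E i)) = prod_list (map catalan_law ys)"
    proof -
      have "(\<Prod>i\<in>?J2. prob (?E i)) = (\<Prod>j\<in>{1..length ys}. catalan_law (ys ! (j - 1)))"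
      proof -
        have "?E (IY j) = {\<omega> \<in> space P. Y j \<omega> = ys ! (j - 1)}" for j by auto
        then have "prob (?E (IY j)) = catalan_law (ys ! (j - 1))" if "j \<in> {1..length ys}" for j
          using lawY that by simp
        moreover have "inj_on IY {1..length ys}" by (simp add: inj_on_def)
        ultimately show ?thesis by (simp only: prod.reindex o_def cong: prod.cong)
      qed
      also have "\<dots> = prod_list (map catalan_law ys)"
        by (subst prod.list_conv_set_nth) (rule prod.reindex_bij_witness[of _ Suc "\<lambda>i. i - 1"]; auto)
      finally show ?thesis .
    qed
    also have "(\<Prod>i\<in>{IN, IM}. prob (?E i)) = (1/2) ^ Suc (length xs) * (1/2) ^ Suc (length ys)"
      using distN[of "length xs"] distM[of "length ys"]
      by (simp add: vimage_def Int_def conj_commute power_divide)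
    finally show "prob (L -` {(xs, ys)} \<inter> space P) = pmf renewal_pmf xs * pmf renewal_pmf ys"
      unfolding L pmf_renewal_pmf by (simp only: mult_ac)
  qed
  have L_meas: "L \<in> measurable P (count_space UNIV)"
    by (subst measurable_count_space_eq2_countable) (auto simp del: vimage_singleton_eq intro!: fibre(1))
  have distr_L: "distr P (count_space UNIV) L = measure_pmf (pair_pmf renewal_pmf renewal_pmf)"
  proof (rule measure_eqI_countable[where A = UNIV])
    fix z :: "nat list \<times> nat list"
    obtain xs ys where z: "z = (xs, ys)" by (cases z)
    have "emeasure (distr P (count_space UNIV) L) {z} = ennreal (prob (L -` {(xs, ys)} \<inter> space P))"
      using L_meas by (simp add: emeasure_distr emeasure_eq_measure z)
    also have "\<dots> = emeasure (measure_pmf (pair_pmf renewal_pmf renewal_pmf)) {z}"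
      unfolding fibre(2) z by (simp add: emeasure_pmf_single pmf_pair)
    finally show "emeasure (distr P (count_space UNIV) L) {z} =
        emeasure (measure_pmf (pair_pmf renewal_pmf renewal_pmf)) {z}" .
  qed auto

  \<comment> \<open>\<open>F\<close> is bounded only on \<open>MF \<times> MF\<close>. Extending by
    \<open>0\<close> gives a function bounded on all pairs of sets, unchanged on the supports of the
    laws.\<close>
  define G where "G = (\<lambda>(A, B). if finite A \<and> 0 \<notin> A \<and> finite B \<and> 0 \<notin> B
      then F (indicat_real A, indicat_real B) else 0)"
  obtain C where C: "\<And>z. z \<in> MF \<times> MF \<Longrightarrow> \<bar>F z\<bar> \<le> C"
    using bdd unfolding bounded_iff by auto
  have "\<bar>G (A, B)\<bar> \<le> max C 0" for A B
  proof (cases "finite A \<and> 0 \<notin> A \<and> finite B \<and> 0 \<notin> B")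
    case True
    then have "\<bar>F (indicat_real A, indicat_real B)\<bar> \<le> C" by (intro C) (simp add: indicator_mem_MF)
    then show ?thesis using True by (simp add: G_def)
  qed (auto simp: G_def)
  then have "\<bar>G z\<bar> \<le> max C 0" for z by (cases z) simp
  note lim = expectation_tendsto_of_pmf_tendsto[of halves_pmf "pair_pmf fix_pmf fix_pmf" G, OF _ this]
  have "(\<lambda>n. measure_pmf.expectation (halves_pmf n) G)
      \<longlonglongrightarrow> measure_pmf.expectation (pair_pmf fix_pmf fix_pmf) G"
    by (rule lim) (use pmf_halves_tendsto in auto)
  moreover have "measure_pmf.expectation (halves_pmf n) G =
      measure_pmf.expectation (pmf_of_set (Av n pat321 3)) (\<lambda>\<tau>. F (fix_left n \<tau>, fix_right n \<tau>))" for n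
    unfolding halves_pmf_def map_pmf_of_set_Av[symmetric] map_pmf_comp integral_map_pmf
    by (rule Bochner_Integration.integral_cong)
       (auto simp: G_def fix_left_eq fix_right_eq left_half_def right_half_def reflect_def)
  moreover have "measure_pmf.expectation (pair_pmf fix_pmf fix_pmf) G =
      (\<integral>\<omega>. F (limit_measure (N \<omega>) (\<lambda>j. X j \<omega>), limit_measure (M \<omega>) (\<lambda>j. Y j \<omega>)) \<partial>P)"
  proof -
    let ?l = "\<lambda>xs. limit_measure (length xs) (\<lambda>j. xs ! (j - 1))"
    have lm: "limit_measure n Z = ?l (map Z [1..<Suc n])" for n Z
    proof -
      have nth: "map Z [1..<Suc n] ! (j - 1) = Z j" if "j \<in> {1..n}" for j
        using that by (auto simp del: upt_Suc)
      have "(\<Sum>j=1..k. map Z [1..<Suc n] ! (j - 1)) = (\<Sum>j=1..k. Z j)" if "k \<le> n" for k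
        by (rule sum.cong[OF refl]) (use nth that in auto)
      then show ?thesis unfolding limit_measure_def
        using nth by (intro ext sum.cong) (auto simp del: upt_Suc)
    qed
    have "measure_pmf.expectation (pair_pmf fix_pmf fix_pmf) G =
        measure_pmf.expectation (pair_pmf renewal_pmf renewal_pmf)
          (\<lambda>z. G (unit_renewals (fst z), unit_renewals (snd z)))"
      by (simp only: fix_pmf_def map_pair[symmetric] integral_map_pmf case_prod_unfold)
    also have "\<dots> = measure_pmf.expectation (pair_pmf renewal_pmf renewal_pmf)
          (\<lambda>z. F (?l (fst z), ?l (snd z)))"
    proof (rule integral_cong_AE)
      show "AE z in pair_pmf renewal_pmf renewal_pmf.
          G (unit_renewals (fst z), unit_renewals (snd z)) = F (?l (fst z), ?l (snd z))"
        using set_renewal_pmf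
        by (auto simp: AE_measure_pmf_iff G_def limit_measure_list zero_notin_unit_renewals simp del: One_nat_def)
    qed auto
    \<comment> \<open>Every function on the discrete space of list pairs is measurable, so the
      integral can be transported along \<open>L\<close>.\<close>
    also have "\<dots> = (\<integral>\<omega>. F (?l (fst (L \<omega>)), ?l (snd (L \<omega>))) \<partial>P)"
      unfolding distr_L[symmetric] by (rule integral_distr[OF L_meas]) simp
    also have "\<dots> = (\<integral>\<omega>. F (limit_measure (N \<omega>) (\<lambda>j. X j \<omega>), limit_measure (M \<omega>) (\<lambda>j. Y j \<omega>)) \<partial>P)"
      by (simp only: L_def fst_conv snd_conv lm[symmetric])
    finally show ?thesis .
  qed
  ultimately show "(\<lambda>n. measure_pmf.expectation (pmf_of_set (Av n pat321 3))
            (\<lambda>\<tau>. F (fix_left n \<tau>, fix_right n \<tau>)))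
     \<longlonglongrightarrow> (\<integral>\<omega>. F (limit_measure (N \<omega>) (\<lambda>j. X j \<omega>), limit_measure (M \<omega>) (\<lambda>j. Y j \<omega>)) \<partial>P)"
    by simp
qed

end
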